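(* Suppose $n > 1$. Let $\varphi_1$ and $\varphi_2$ be nonconstant inner functions in $H^{\infty}(\mathbb{D}^n)$. Then the truncated Toeplitz operator $T_{\varphi_2}^{\varphi_1}$ is an isometry on $\mathcal{Q}_{\varphi_1}$ if and only if the truncated Toeplitz operator $T_{\varphi_1}^{\varphi_2}$ is an isometry on $\mathcal{Q}_{\varphi_2}$.
   Context: $\mathbb{D}^n$ is the open unit polydisc in $\mathbb{C}^n$ and $\mathbb{T}^n$ its distinguished boundary. $H^\infty(\mathbb{D}^n)$ is the algebra of bounded analytic functions on $\mathbb{D}^n$. $H^2(\mathbb{D}^n)$ is the Hardy space of analytic functions $f$ on $\mathbb{D}^n$ with $\|f\|^2 = \sup_{0 \le r < 1} \int_{\mathbb{T}^n} |f(rz_1,\ldots,rz_n)|^2\, dm(z) < \infty$, where $m$ is normalized Lebesgue measure on $\mathbb{T}^n$. A function $\varphi \in H^\infty(\mathbb{D}^n)$ is inner if its radial boundary values satisfy $|\varphi(z)| = 1$ for almost every $z \in \mathbb{T}^n$. The model space of an inner function $\varphi$ is $\mathcal{Q}_\varphi = H^2(\mathbb{D}^n) \ominus \varphi H^2(\mathbb{D}^n)$. For inner functions $\varphi, \theta$, the truncated Toeplitz operator $T^{\varphi}_{\theta} : \mathcal{Q}_{\varphi} \to \mathcal{Q}_{\varphi}$ is defined by $T^{\varphi}_{\theta} f = P_{\mathcal{Q}_{\varphi}}(\theta f)$, where $P_{\mathcal{Q}_{\varphi}}$ is the orthogonal projection onto $\mathcal{Q}_{\varphi}$. *)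

theory Defs
  imports "HOL-Probability.Probability"
begin

definition polydisc :: "(complex ^ 'n) set" where
  "polydisc = {z. \<forall>i. norm (z $ i) < 1}"

text \<open>Analyticity in several variables: the Frechet derivative exists and is complex linear.
  (Used for open \<open>S\<close> only.)\<close>

definition analytic_several_on ::
    "(complex ^ 'n::finite \<Rightarrow> complex) \<Rightarrow> (complex ^ 'n) set \<Rightarrow> bool" where
  "analytic_several_on f S \<longleftrightarrow>
     (\<forall>z\<in>S. \<exists>D. (f has_derivative D) (at z) \<and> (\<forall>c v. D (c *s v) = c * D v))"

text \<open>Normalized Lebesgue measure on the distinguished boundary, as a Borel measure on the whole
  of \<open>complex ^ 'n\<close> concentrated on the torus.\<close>

definition torus_measure :: "(complex ^ 'n::finite) measure" where
  "torus_measure =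
     distr (Pi\<^sub>M (UNIV :: 'n set) (\<lambda>_. uniform_measure lborel {0..2 * pi})) borel
       (\<lambda>t. \<chi> i. cis (t i))"

lemma prob_space_torus_measure: "prob_space (torus_measure :: (complex ^ 'n::finite) measure)"
proof -
  let ?U = "uniform_measure lborel {0..2 * pi} :: real measure"
  have U: "prob_space ?U"
    by (rule prob_space_uniform_measure) (auto simp: emeasure_lborel_Icc_eq)
  interpret product_prob_space "\<lambda>_::'n. ?U" UNIV
    using U by (simp add: product_prob_space_def product_prob_space_axioms_def
        product_sigma_finite_def prob_space_imp_sigma_finite)
  have "(\<lambda>t. \<chi> i. cis (t i)) \<in> borel_measurable (Pi\<^sub>M (UNIV :: 'n set) (\<lambda>_. ?U))"
  proof (rule borel_measurable_euclidean_space[THEN iffD2], intro ballI)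
    fix b :: "complex ^ 'n" assume "b \<in> Basis"
    then obtain i u where b: "b = axis i u" by (auto simp: Basis_vec_def)
    have c: "cis \<in> borel_measurable borel"
      by (intro borel_measurable_continuous_onI continuous_intros)
    have "(\<lambda>t. t i) \<in> measurable (Pi\<^sub>M (UNIV :: 'n set) (\<lambda>_. ?U)) ?U"
      by (rule measurable_component_singleton) simp
    then have "(\<lambda>t. t i) \<in> borel_measurable (Pi\<^sub>M (UNIV :: 'n set) (\<lambda>_. ?U))"
      by (simp cong: measurable_cong_sets)
    from measurable_compose[OF this c]
    have "(\<lambda>t. cis (t i) \<bullet> u) \<in> borel_measurable (Pi\<^sub>M (UNIV :: 'n set) (\<lambda>_. ?U))"
      by (rule borel_measurable_inner) simp
    then show "(\<lambda>t. (\<chi> i. cis (t i)) \<bullet> b) \<in> borel_measurable (Pi\<^sub>M (UNIV :: 'n set) (\<lambda>_. ?U))"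
      by (simp add: b inner_axis)
  qed
  then show ?thesis
    unfolding torus_measure_def by (rule prob_space_distr)
qed

definition H_infinity :: "(complex ^ 'n::finite \<Rightarrow> complex) set" where
  "H_infinity = {f. analytic_several_on f polydisc \<and> bounded (f ` polydisc)}"

text \<open>Elements of the Hardy space are functions on the polydisc; they are represented by total
  functions vanishing outside it, so that equality in \<open>H2\<close> is equality of functions.\<close>

definition H2 :: "(complex ^ 'n::finite \<Rightarrow> complex) set" where
  "H2 = {f. analytic_several_on f polydisc \<and> (\<forall>z. z \<notin> polydisc \<longrightarrow> f z = 0) \<and>
     bdd_above ((\<lambda>r::real. \<integral>z. (norm (f (r *\<^sub>R z)))\<^sup>2 \<partial>torus_measure) ` {0..<1})}"

definition H2_norm :: "(complex ^ 'n::finite \<Rightarrow> complex) \<Rightarrow> real" where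
  "H2_norm f = sqrt (SUP r\<in>{0..<1::real}. \<integral>z. (norm (f (r *\<^sub>R z)))\<^sup>2 \<partial>torus_measure)"

text \<open>The inner product inducing \<open>H2_norm\<close>: the integral means increase with \<open>r\<close>, so the
  supremum in the norm is a limit, and the limit below exists by polarization.\<close>

definition H2_inner ::
    "(complex ^ 'n::finite \<Rightarrow> complex) \<Rightarrow> (complex ^ 'n \<Rightarrow> complex) \<Rightarrow> complex" where
  "H2_inner f g =
     Lim (at_left (1::real)) (\<lambda>r. \<integral>z. f (r *\<^sub>R z) * cnj (g (r *\<^sub>R z)) \<partial>torus_measure)"

definition inner_function :: "(complex ^ 'n::finite \<Rightarrow> complex) \<Rightarrow> bool" where
  "inner_function \<phi> \<longleftrightarrow> \<phi> \<in> H_infinity \<and>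
     (AE z in torus_measure.
        \<exists>l. ((\<lambda>r::real. \<phi> (r *\<^sub>R z)) \<longlongrightarrow> l) (at_left 1) \<and> norm l = 1)"

definition model_space ::
    "(complex ^ 'n::finite \<Rightarrow> complex) \<Rightarrow> (complex ^ 'n \<Rightarrow> complex) set" where
  "model_space \<phi> = {f \<in> H2. \<forall>g\<in>H2. H2_inner f (\<lambda>z. \<phi> z * g z) = 0}"

text \<open>Meaningful for a closed subspace \<open>S\<close> of \<open>H2\<close> and \<open>f \<in> H2\<close>, where the vector described
  exists and is unique.\<close>

definition H2_proj ::
    "(complex ^ 'n::finite \<Rightarrow> complex) set \<Rightarrow> (complex ^ 'n \<Rightarrow> complex) \<Rightarrow> complex ^ 'n \<Rightarrow> complex" where
  "H2_proj S f = (THE g. g \<in> S \<and> (\<forall>h\<in>S. H2_inner (\<lambda>z. f z - g z) h = 0))"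

text \<open>\<open>truncated_toeplitz \<phi> \<theta>\<close> has symbol \<open>\<theta>\<close> and acts on the model space of \<open>\<phi>\<close>.\<close>

definition truncated_toeplitz ::
    "(complex ^ 'n::finite \<Rightarrow> complex) \<Rightarrow> (complex ^ 'n \<Rightarrow> complex)
      \<Rightarrow> (complex ^ 'n \<Rightarrow> complex) \<Rightarrow> complex ^ 'n \<Rightarrow> complex" where
  "truncated_toeplitz \<phi> \<theta> f = H2_proj (model_space \<phi>) (\<lambda>z. \<theta> z * f z)"

definition H2_isometry_on ::
    "(complex ^ 'n::finite \<Rightarrow> complex) set
      \<Rightarrow> ((complex ^ 'n \<Rightarrow> complex) \<Rightarrow> (complex ^ 'n \<Rightarrow> complex)) \<Rightarrow> bool" where
  "H2_isometry_on S T \<longleftrightarrow> (\<forall>f\<in>S. H2_norm (T f) = H2_norm f)"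

end

theory Submission
  imports Defs "HOL-Complex_Analysis.Cauchy_Integral_Formula"
begin

text \<open>
  Let \<open>M \<phi>\<close> denote multiplication by an inner function \<open>\<phi>\<close>. It is an isometry of the Hardy space, so
  its range is closed and every \<open>h\<close> splits as \<open>h = f + M \<phi> k\<close> with \<open>f\<close> in the model space of \<open>\<phi>\<close>.
  Since \<open>M \<theta>\<close> is isometric and an orthogonal projection preserves the norm exactly of the vectors
  that it fixes, the truncated Toeplitz operator with symbol \<open>\<theta>\<close> is an isometry if and only if \<open>M \<theta>\<close>
  maps the model space of \<open>\<phi>\<close> into itself (\<open>isometry_iff_invariant\<close>).

  This invariance is symmetric in \<open>\<phi>\<close> and \<open>\<theta>\<close> (\<open>model_space_invariant_swap\<close>): if \<open>g\<close> is in the model space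
  of \<open>\<theta>\<close> and \<open>h = f + M \<phi> k\<close> as above, then \<open>M \<phi> g\<close> is orthogonal to \<open>M \<theta> f\<close>, which by the invariance lies in
  the model space of \<open>\<phi>\<close>, and its inner product with \<open>M \<theta> (M \<phi> k) = M \<phi> (M \<theta> k)\<close> is that of \<open>g\<close> with \<open>M \<theta> k\<close>, namely 0.
  So \<open>M \<phi> g\<close> is orthogonal to \<open>M \<theta> h\<close> for every \<open>h\<close>.

  The bulk of the work is to make the Hardy space a Hilbert space on which \<open>M \<phi>\<close> is isometric.
  Restricting a function \<open>f\<close> to the discs \<open>w \<mapsto> w z\<close> with \<open>z\<close> on the torus reduces integrals over the torus
  to Parseval's identity on the circle. It yields that the means of \<open>(norm f)\<^sup>2\<close> increase with the radius
  (\<open>torus_mean_mono\<close>) and that the mean of \<open>f (r z) * cnj (f (s z))\<close> depends on \<open>r * s\<close> only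
  (\<open>torus_mean_swap_radii\<close>). By the first fact the inner product exists as a limit. Completeness follows
  from a bound of point values by the norm (\<open>analytic_point_bound\<close>) and from the closure of analytic
  functions under locally uniform limits (\<open>analytic_limit\<close>). By the second fact the dilates
  \<open>z \<mapsto> f (c z)\<close> converge to \<open>f\<close> in norm as \<open>c\<close> tends to 1 (\<open>dilate_approximates\<close>). Dilates are bounded and
  continuous up to the torus, so for them \<open>norm (M \<phi> f) = norm f\<close> follows from dominated convergence
  (\<open>norm_mult_inner_dilate\<close>), and by density it holds for all \<open>f\<close>.
\<close>

section \<open>Rotations and Fourier series on the circle\<close>

definition circle :: "complex measure" where
  "circle = distr (uniform_measure lborel {0..2 * pi}) borel cis"

lemma measurable_cis [measurable]: "cis \<in> borel_measurable borel"
  by (intro borel_measurable_continuous_onI continuous_intros)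

lemma measurable_cnj [measurable]: "cnj \<in> borel_measurable borel"
  by (intro borel_measurable_continuous_onI continuous_intros)

lemma sets_circle [simp, measurable_cong]: "sets circle = sets borel"
  by (simp add: circle_def)

lemma space_circle [simp]: "space circle = UNIV"
  by (simp add: circle_def)

lemma prob_space_arc: "prob_space (uniform_measure lborel {0..2 * pi} :: real measure)"
  by (rule prob_space_uniform_measure) (auto simp: emeasure_lborel_Icc_eq)

interpretation circle: prob_space circle
  unfolding circle_def
  by (rule prob_space.prob_space_distr[OF prob_space_arc]) simp

lemma prob_circle_UNIV [simp]: "measure circle UNIV = 1"
  using circle.prob_space by simp

lemma AE_circle: "AE z in circle. norm z = 1"
  unfolding circle_def by (subst AE_distr_iff) auto

lemma nn_integral_circle:
  assumes [measurable]: "g \<in> borel_measurable borel"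
  shows "(\<integral>\<^sup>+z. g z \<partial>circle) = (\<integral>\<^sup>+t. g (cis t) * indicator {0..2*pi} t \<partial>lborel) / ennreal (2*pi)"
  unfolding circle_def
  by (subst nn_integral_distr)
    (auto simp: nn_integral_uniform_measure emeasure_lborel_Icc_eq)

text \<open>The translate of the interval of angles is cut at \<open>2 * pi\<close> and its far piece is moved
  back by a full turn.\<close>

lemma nn_integral_circle_rotate:
  assumes [measurable]: "g \<in> borel_measurable borel" and a: "a \<in> {0..2*pi}"
  shows "(\<integral>\<^sup>+z. g (cis a * z) \<partial>circle) = (\<integral>\<^sup>+z. g z \<partial>circle)"
proof -
  define h where "h t = g (cis t)" for t
  have [measurable]: "h \<in> borel_measurable borel"
    unfolding h_def by measurable
  have per: "h (t + 2*pi) = h t" for t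
    by (simp add: h_def flip: cis_mult)
  have shift: "(\<integral>\<^sup>+t. f (t + c) \<partial>lborel) = (\<integral>\<^sup>+t. f t \<partial>lborel)"
    if [measurable]: "f \<in> borel_measurable borel" for f :: "real \<Rightarrow> ennreal" and c
    using nn_integral_real_affine[of f 1 c] that by (simp add: add.commute)
  have "(\<integral>\<^sup>+t. h (t + a) * indicator {0..2*pi} t \<partial>lborel)
      = (\<integral>\<^sup>+t. h t * indicator {0..2*pi} (t - a) \<partial>lborel)"
    using shift[of "\<lambda>t. h t * indicator {0..2*pi} (t - a)" a] by simp
  also have "\<dots> = (\<integral>\<^sup>+t. h t * indicator {a<..2*pi} t + h t * indicator {2*pi<..a+2*pi} t \<partial>lborel)"
  proof (intro nn_integral_cong_AE)
    have "AE t in lborel. t \<noteq> a" by (rule AE_lborel_singleton)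
    then show "AE t in lborel. h t * indicator {0..2*pi} (t - a)
         = h t * indicator {a<..2*pi} t + h t * indicator {2*pi<..a+2*pi} t"
      by eventually_elim (use a in \<open>auto simp: indicator_def\<close>)
  qed
  also have "\<dots> = (\<integral>\<^sup>+t. h t * indicator {a<..2*pi} t \<partial>lborel)
                + (\<integral>\<^sup>+t. h t * indicator {2*pi<..a+2*pi} t \<partial>lborel)"
    by (rule nn_integral_add) auto
  also have "(\<integral>\<^sup>+t. h t * indicator {2*pi<..a+2*pi} t \<partial>lborel)
      = (\<integral>\<^sup>+t. h (t + 2*pi) * indicator {2*pi<..a+2*pi} (t + 2*pi) \<partial>lborel)"
    using shift[of "\<lambda>t. h t * indicator {2*pi<..a+2*pi} t" "2*pi"] by simp
  also have "\<dots> = (\<integral>\<^sup>+t. h t * indicator {0<..a} t \<partial>lborel)"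
    by (intro nn_integral_cong) (auto simp: per indicator_def)
  also have "(\<integral>\<^sup>+t. h t * indicator {a<..2*pi} t \<partial>lborel) + (\<integral>\<^sup>+t. h t * indicator {0<..a} t \<partial>lborel)
      = (\<integral>\<^sup>+t. h t * indicator {a<..2*pi} t + h t * indicator {0<..a} t \<partial>lborel)"
    by (rule nn_integral_add[symmetric]) auto
  also have "\<dots> = (\<integral>\<^sup>+t. h t * indicator {0..2*pi} t \<partial>lborel)"
  proof (intro nn_integral_cong_AE)
    have "AE t in lborel. t \<noteq> (0::real)" by (rule AE_lborel_singleton)
    then show "AE t in lborel. h t * indicator {a<..2*pi} t + h t * indicator {0<..a} t
         = h t * indicator {0..2*pi} t"
      by eventually_elim (use a in \<open>auto simp: indicator_def\<close>)
  qed
  finally show ?thesis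
    by (simp add: nn_integral_circle h_def cis_mult add.commute)
qed

lemma distr_circle_rotate:
  assumes a: "a \<in> {0..2*pi}"
  shows "distr circle borel ((*) (cis a)) = circle"
proof (rule measure_eqI)
  fix A assume "A \<in> sets (distr circle borel ((*) (cis a)))"
  then have [measurable]: "A \<in> sets borel" by simp
  have "emeasure (distr circle borel ((*) (cis a))) A
      = (\<integral>\<^sup>+z. indicator A z \<partial>distr circle borel ((*) (cis a)))" by simp
  also have "\<dots> = (\<integral>\<^sup>+z. indicator A (cis a * z) \<partial>circle)"
    by (subst nn_integral_distr) auto
  also have "\<dots> = emeasure circle A"
    by (subst nn_integral_circle_rotate[OF _ a]) auto
  finally show "emeasure (distr circle borel ((*) (cis a))) A = emeasure circle A" .
qed simp

text \<open>A nontrivial character is multiplied by \<open>- 1\<close> under a suitable rotation, so its mean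
  vanishes.\<close>

lemma integral_circle_characters:
  "(\<integral>z. z ^ j * cnj z ^ k \<partial>circle) = (if j = k then 1 else 0)"
proof (cases "j = k")
  case True
  have "(\<integral>z. z ^ j * cnj z ^ k \<partial>circle) = (\<integral>z. 1 \<partial>circle)"
  proof (rule integral_cong_AE)
    show "AE z in circle. z ^ j * cnj z ^ k = 1"
      using AE_circle
    proof eventually_elim
      case (elim z)
      then show ?case
        using True by (metis complex_norm_square mult_1 of_real_1 one_power2 power_mult_distrib power_one)
    qed
  qed measurable
  then show ?thesis using True by simp
next
  case False
  \<comment> \<open>Rotating by \<open>pi / m\<close> changes the sign of the character of frequency \<open>m\<close> or \<open>- m\<close>.\<close>
  define m where "m = (if j < k then k - j else j - k)"
  define a where "a = pi / real m"
  have m: "m \<ge> 1" using False by (auto simp: m_def)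
  then have a: "a \<in> {0..2*pi}"
    using mult_left_mono[of 1 "real m" "2*pi"] by (auto simp: a_def field_simps)
  have am: "cis (real m * a) = -1" using m by (simp add: a_def)
  have key: "cis a ^ j * cnj (cis a) ^ k = -1"
  proof (cases "j < k")
    case True
    then have k: "k = j + m" by (simp add: m_def)
    have "cis a ^ j * cnj (cis a) ^ k = (cis a * cnj (cis a)) ^ j * cnj (cis a ^ m)"
      by (simp add: k power_add power_mult_distrib)
    also have "\<dots> = -1" using am by (simp add: cis_mult cis_cnj Complex.DeMoivre)
    finally show ?thesis .
  next
    case F: False
    then have k: "j = k + m" using False by (simp add: m_def)
    have "cis a ^ j * cnj (cis a) ^ k = (cis a * cnj (cis a)) ^ k * (cis a ^ m)"
      by (simp add: k power_add power_mult_distrib)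
    also have "\<dots> = -1" using am by (simp add: cis_mult cis_cnj Complex.DeMoivre)
    finally show ?thesis .
  qed
  have "(\<integral>z. z ^ j * cnj z ^ k \<partial>circle) = (\<integral>z. z ^ j * cnj z ^ k \<partial>distr circle borel ((*) (cis a)))"
    by (simp add: distr_circle_rotate[OF a])
  also have "\<dots> = (\<integral>z. (cis a * z) ^ j * cnj (cis a * z) ^ k \<partial>circle)"
    by (subst integral_distr) auto
  also have "\<dots> = (\<integral>z. (cis a ^ j * cnj (cis a) ^ k) * (z ^ j * cnj z ^ k) \<partial>circle)"
    by (intro Bochner_Integration.integral_cong) (auto simp: power_mult_distrib algebra_simps)
  also have "\<dots> = - (\<integral>z. z ^ j * cnj z ^ k \<partial>circle)"
    unfolding key by simp
  finally show ?thesis using False by simp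
qed

text \<open>Parseval's identity, polarized. Absolute summability bounds all partial sums on the circle, so both
  series may be integrated term by term, and only the products of equal characters survive.\<close>

lemma integral_circle_series:
  fixes a b :: "nat \<Rightarrow> complex"
  assumes a: "summable (\<lambda>k. norm (a k))" and b: "summable (\<lambda>k. norm (b k))"
  shows "(\<integral>z. (\<Sum>j. a j * z ^ j) * cnj (\<Sum>k. b k * z ^ k) \<partial>circle) = (\<Sum>k. a k * cnj (b k))"
proof -
  have sm: "summable (\<lambda>k. norm (c k * z ^ k))"
    if "summable (\<lambda>k. norm (c k))" "norm z = 1" for c :: "nat \<Rightarrow> complex" and z
    using that by (simp add: norm_mult norm_power)
  have coeff: "(\<integral>z. (\<Sum>j. a j * z ^ j) * cnj z ^ k \<partial>circle) = a k" for k
  proof -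
    have meas[measurable]: "(\<lambda>z::complex. a j * z ^ j * cnj z ^ k) \<in> borel_measurable borel" for j
      by (intro borel_measurable_continuous_onI continuous_intros)
    have "(\<integral>z. (\<Sum>j. a j * z ^ j) * cnj z ^ k \<partial>circle) = (\<integral>z. (\<Sum>j. a j * z ^ j * cnj z ^ k) \<partial>circle)"
    proof (rule integral_cong_AE)
      show "AE z in circle. (\<Sum>j. a j * z ^ j) * cnj z ^ k = (\<Sum>j. a j * z ^ j * cnj z ^ k)"
        using AE_circle
        by eventually_elim (rule suminf_mult2[OF summable_norm_cancel[OF sm[OF a]]])
    qed measurable
    also have "\<dots> = (\<Sum>j. \<integral>z. a j * z ^ j * cnj z ^ k \<partial>circle)"
    proof (rule integral_suminf)
      have n: "(\<integral>z. norm (a j * z ^ j * cnj z ^ k) \<partial>circle) = norm (a j)" for j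
      proof -
        have "AE z in circle. norm (a j * z ^ j * cnj z ^ k) = norm (a j)"
          using AE_circle by eventually_elim (simp add: norm_mult norm_power)
        then have "(\<integral>z. norm (a j * z ^ j * cnj z ^ k) \<partial>circle) = (\<integral>z. norm (a j) \<partial>circle)"
          by (rule integral_cong_AE[rotated 2]) measurable
        then show ?thesis by simp
      qed
      show "integrable circle (\<lambda>z. a j * z ^ j * cnj z ^ k)" for j
        by (rule circle.integrable_const_bound[where B="norm (a j)"])
           (use AE_circle in \<open>auto simp: norm_mult norm_power elim!: eventually_mono\<close>)
      show "AE z in circle. summable (\<lambda>j. norm (a j * z ^ j * cnj z ^ k))"
        using AE_circle by eventually_elim (use a in \<open>simp add: norm_mult norm_power\<close>)
      show "summable (\<lambda>j. \<integral>z. norm (a j * z ^ j * cnj z ^ k) \<partial>circle)"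
        using a by (simp add: n)
    qed
    also have "\<dots> = (\<Sum>j. if j = k then a j else 0)"
      by (intro suminf_cong) (auto simp: integral_circle_characters mult.assoc)
    also have "\<dots> = a k"
      using sums_single[of k a] by (simp add: sums_iff)
    finally show ?thesis .
  qed
  define A where "A = (\<Sum>k. norm (a k))"
  have Ab: "norm (\<Sum>j. a j * z ^ j) \<le> A" if "norm z = 1" for z
    using summable_norm[OF sm[OF a that]] that by (simp add: A_def norm_mult norm_power)
  have meas[measurable]: "(\<lambda>z::complex. (\<Sum>j. a j * z ^ j) * cnj (b k * z ^ k)) \<in> borel_measurable borel" for k
    by measurable
  have "(\<integral>z. (\<Sum>j. a j * z ^ j) * cnj (\<Sum>k. b k * z ^ k) \<partial>circle)
      = (\<integral>z. (\<Sum>k. (\<Sum>j. a j * z ^ j) * cnj (b k * z ^ k)) \<partial>circle)"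
  proof (rule integral_cong_AE)
    show "AE z in circle. (\<Sum>j. a j * z ^ j) * cnj (\<Sum>k. b k * z ^ k)
        = (\<Sum>k. (\<Sum>j. a j * z ^ j) * cnj (b k * z ^ k))"
      using AE_circle
    proof eventually_elim
      case (elim z)
      have s: "summable (\<lambda>k. b k * z ^ k)" by (rule summable_norm_cancel[OF sm[OF b elim]])
      have "cnj (\<Sum>k. b k * z ^ k) = (\<Sum>k. cnj (b k * z ^ k))"
        by (rule bounded_linear.suminf[OF bounded_linear_cnj s])
      then show ?case
        by (simp only:) (rule suminf_mult[symmetric, OF bounded_linear.summable[OF bounded_linear_cnj s]])
    qed
  qed measurable
  also have "\<dots> = (\<Sum>k. \<integral>z. (\<Sum>j. a j * z ^ j) * cnj (b k * z ^ k) \<partial>circle)"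
  proof (rule integral_suminf)
    have bd: "AE z in circle. norm ((\<Sum>j. a j * z ^ j) * cnj (b k * z ^ k)) \<le> A * norm (b k)" for k
      using AE_circle
      by eventually_elim (use Ab in \<open>auto simp: norm_mult norm_power intro!: mult_right_mono\<close>)
    show i: "integrable circle (\<lambda>z. (\<Sum>j. a j * z ^ j) * cnj (b k * z ^ k))" for k
      by (rule circle.integrable_const_bound[OF bd]) auto
    show "AE z in circle. summable (\<lambda>k. norm ((\<Sum>j. a j * z ^ j) * cnj (b k * z ^ k)))"
      using AE_circle by eventually_elim (use b in \<open>simp add: norm_mult norm_power summable_mult\<close>)
    show "summable (\<lambda>k. \<integral>z. norm ((\<Sum>j. a j * z ^ j) * cnj (b k * z ^ k)) \<partial>circle)"
    proof (rule summable_comparison_test'[where N=0])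
      show "summable (\<lambda>k. A * norm (b k))" using b by (rule summable_mult)
      have "(\<integral>z. norm ((\<Sum>j. a j * z ^ j) * cnj (b k * z ^ k)) \<partial>circle) \<le> A * norm (b k)" for k
        using bd integrable_norm[OF i] by (rule circle.integral_le_const[rotated])
      then show "norm (\<integral>z. norm ((\<Sum>j. a j * z ^ j) * cnj (b k * z ^ k)) \<partial>circle) \<le> A * norm (b k)" for k
        by (subst real_norm_def, subst abs_of_nonneg) auto
    qed
  qed
  also have "\<dots> = (\<Sum>k. a k * cnj (b k))"
  proof (rule suminf_cong)
    fix k
    have "(\<integral>z. (\<Sum>j. a j * z ^ j) * cnj (b k * z ^ k) \<partial>circle)
        = (\<integral>z. cnj (b k) * ((\<Sum>j. a j * z ^ j) * cnj z ^ k) \<partial>circle)"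
      by (intro Bochner_Integration.integral_cong) (auto simp: algebra_simps)
    also have "\<dots> = cnj (b k) * (\<integral>z. (\<Sum>j. a j * z ^ j) * cnj z ^ k \<partial>circle)"
      by simp
    finally show "(\<integral>z. (\<Sum>j. a j * z ^ j) * cnj (b k * z ^ k) \<partial>circle) = a k * cnj (b k)"
      by (simp add: coeff)
  qed
  finally show ?thesis .
qed

lemma distr_circle_mult:
  assumes "norm w = 1"
  shows "distr circle borel ((*) w) = circle"
proof -
  have "cis (Arg2pi w) = w"
    using complex_norm_eq_1_exp[of w] assms by (simp add: cis_conv_exp)
  then show ?thesis
    using distr_circle_rotate[of "Arg2pi w"] Arg2pi_ge_0[of w] Arg2pi_lt_2pi[of w] by simp
qed

section \<open>Circle means of holomorphic functions\<close>

lemma holomorphic_unit_disc_series: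
  assumes "g holomorphic_on ball 0 1"
  obtains a :: "nat \<Rightarrow> complex" where
    "\<And>z. norm z < 1 \<Longrightarrow> (\<lambda>k. a k * z ^ k) sums g z"
    "\<And>z. norm z < 1 \<Longrightarrow> summable (\<lambda>k. norm (a k * z ^ k))"
proof
  define a where "a k = (deriv ^^ k) g 0 / fact k" for k
  show sums: "(\<lambda>k. a k * z ^ k) sums g z" if "norm z < 1" for z
    using holomorphic_power_series[OF assms, of z] that by (simp add: a_def)
  show "summable (\<lambda>k. norm (a k * z ^ k))" if "norm z < 1" for z
  proof (rule powser_insidea)
    define w :: complex where "w = of_real ((norm z + 1) / 2)"
    have w: "norm w = (norm z + 1) / 2"
      unfolding w_def norm_of_real by simp
    show "summable (\<lambda>k. a k * w ^ k)"
      using sums[of w] w that by (simp add: sums_iff)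
    show "norm z < norm w" using w that by simp
  qed
qed

text \<open>With \<open>a\<close> the Taylor coefficients of \<open>g\<close>, the numbers \<open>c k\<close> are \<open>(norm (a k))\<^sup>2\<close>. What matters is that
  they are nonnegative and that the radii enter through their product.\<close>

lemma circle_mean_product:
  assumes hol: "g holomorphic_on ball 0 1" and [measurable]: "g \<in> borel_measurable borel"
  obtains c :: "nat \<Rightarrow> real" where
    "\<And>k. c k \<ge> 0"
    "\<And>t. 0 \<le> t \<Longrightarrow> t < 1 \<Longrightarrow> summable (\<lambda>k. c k * t ^ k)"
    "\<And>r s. 0 \<le> r \<Longrightarrow> r < 1 \<Longrightarrow> 0 \<le> s \<Longrightarrow> s < 1 \<Longrightarrow>
       (\<integral>z. g (of_real r * z) * cnj (g (of_real s * z)) \<partial>circle) = of_real (\<Sum>k. c k * (r * s) ^ k)"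
proof -
  obtain a where a: "\<And>z. norm z < 1 \<Longrightarrow> (\<lambda>k. a k * z ^ k) sums g z"
    "\<And>z. norm z < 1 \<Longrightarrow> summable (\<lambda>k. norm (a k * z ^ k))"
    by (rule holomorphic_unit_disc_series[OF hol]) (rule that)
  have bound: "\<exists>B. \<forall>k. norm (a k * complex_of_real r ^ k) \<le> B" if "0 \<le> r" "r < 1" for r
  proof -
    have "(\<lambda>k. norm (a k * complex_of_real r ^ k)) \<longlonglongrightarrow> 0"
      using a(2)[of "of_real r"] that by (intro summable_LIMSEQ_zero) auto
    then have "Bseq (\<lambda>k. norm (a k * complex_of_real r ^ k))"
      by (intro convergent_imp_Bseq) (auto simp: convergent_def)
    then show ?thesis by (auto simp: Bseq_def)
  qed
  have summ: "summable (\<lambda>k. (norm (a k))\<^sup>2 * t ^ k)" if t: "0 \<le> t" "t < 1" for t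
    proof -
      have s: "0 \<le> sqrt t" "sqrt t < 1" using t by (auto simp: real_sqrt_lt_1_iff)
      obtain B where B: "\<And>k. norm (a k * complex_of_real (sqrt t) ^ k) \<le> B"
        using bound[OF s] by auto
      have eq: "(norm (a k))\<^sup>2 * t ^ k = (norm (a k * complex_of_real (sqrt t) ^ k))\<^sup>2" for k
      proof -
        have "t ^ k = (sqrt t ^ k)\<^sup>2"
          using t by (simp flip: power_mult add: mult.commute[of k 2]) (simp add: power_mult)
        then show ?thesis
          using t by (simp add: norm_mult norm_power power_mult_distrib)
      qed
      show ?thesis
        unfolding eq
      proof (rule summable_comparison_test'[where N=0])
        show "summable (\<lambda>k. B * norm (a k * complex_of_real (sqrt t) ^ k))"
          using a(2)[of "of_real (sqrt t)"] s by (intro summable_mult) auto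
        show "norm ((norm (a k * complex_of_real (sqrt t) ^ k))\<^sup>2)
            \<le> B * norm (a k * complex_of_real (sqrt t) ^ k)" for k
          using mult_right_mono[OF B[of k] norm_ge_zero[of "a k * complex_of_real (sqrt t) ^ k"]]
          by (simp only: power2_eq_square real_norm_def abs_mult abs_norm_cancel)
      qed
    qed
  show ?thesis
  proof
    show "(norm (a k))\<^sup>2 \<ge> 0" for k by simp
    show "summable (\<lambda>k. (norm (a k))\<^sup>2 * t ^ k)" if "0 \<le> t" "t < 1" for t
      by (rule summ[OF that])
    show "(\<integral>z. g (of_real r * z) * cnj (g (of_real s * z)) \<partial>circle)
        = of_real (\<Sum>k. (norm (a k))\<^sup>2 * (r * s) ^ k)"
      if r: "0 \<le> r" "r < 1" and s: "0 \<le> s" "s < 1" for r s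
    proof -
      have exp: "g (of_real t * z) = (\<Sum>k. (a k * of_real t ^ k) * z ^ k)"
        if "0 \<le> t" "t < 1" "norm z = 1" for t z
        using a(1)[of "of_real t * z"] that
        by (simp add: sums_iff norm_mult power_mult_distrib mult.assoc)
      have sm: "summable (\<lambda>k. norm (a k * complex_of_real t ^ k))" if "0 \<le> t" "t < 1" for t
        using a(2)[of "of_real t"] that by simp
      have "(\<integral>z. g (of_real r * z) * cnj (g (of_real s * z)) \<partial>circle)
          = (\<integral>z. (\<Sum>k. (a k * of_real r ^ k) * z ^ k) * cnj (\<Sum>k. (a k * of_real s ^ k) * z ^ k) \<partial>circle)"
      proof (rule integral_cong_AE)
        show "AE z in circle. g (of_real r * z) * cnj (g (of_real s * z))
          = (\<Sum>k. (a k * of_real r ^ k) * z ^ k) * cnj (\<Sum>k. (a k * of_real s ^ k) * z ^ k)"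
          using AE_circle by eventually_elim (use r s exp in simp)
      qed measurable
      also have "\<dots> = (\<Sum>k. (a k * of_real r ^ k) * cnj (a k * of_real s ^ k))"
        by (rule integral_circle_series[OF sm[OF r] sm[OF s]])
      also have "\<dots> = (\<Sum>k. of_real ((norm (a k))\<^sup>2 * (r * s) ^ k))"
        by (intro suminf_cong, unfold of_real_mult complex_norm_square) (simp add: power_mult_distrib mult_ac)
      also have "\<dots> = of_real (\<Sum>k. (norm (a k))\<^sup>2 * (r * s) ^ k)"
        by (rule suminf_of_real[symmetric])
           (use summ[of "r * s"] r s mult_strict_mono[of r 1 s 1] in auto)
      finally show ?thesis .
    qed
  qed
qed

lemma circle_mean_mono:
  assumes "g holomorphic_on ball 0 1" "g \<in> borel_measurable borel" "0 \<le> r" "r \<le> s" "s < 1"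
  shows "(\<integral>z. (norm (g (of_real r * z)))\<^sup>2 \<partial>circle) \<le> (\<integral>z. (norm (g (of_real s * z)))\<^sup>2 \<partial>circle)"
proof -
  obtain c where c: "\<And>k. c k \<ge> 0" "\<And>t. 0 \<le> t \<Longrightarrow> t < 1 \<Longrightarrow> summable (\<lambda>k. c k * t ^ k)"
    "\<And>r s. 0 \<le> r \<Longrightarrow> r < 1 \<Longrightarrow> 0 \<le> s \<Longrightarrow> s < 1 \<Longrightarrow>
       (\<integral>z. g (of_real r * z) * cnj (g (of_real s * z)) \<partial>circle) = of_real (\<Sum>k. c k * (r * s) ^ k)"
    by (rule circle_mean_product[OF assms(1,2)]) (rule that)
  have eq: "(\<integral>z. (norm (g (of_real t * z)))\<^sup>2 \<partial>circle) = (\<Sum>k. c k * (t * t) ^ k)"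
    if "0 \<le> t" "t < 1" for t
  proof -
    have "complex_of_real (\<integral>z. (norm (g (of_real t * z)))\<^sup>2 \<partial>circle)
        = (\<integral>z. g (of_real t * z) * cnj (g (of_real t * z)) \<partial>circle)"
      unfolding complex_norm_square[symmetric] of_real_power[symmetric]
      by (rule integral_complex_of_real[symmetric])
    then show ?thesis using c(3)[OF that that] by (simp only: of_real_eq_iff)
  qed
  have "r * r \<le> s * s" using assms by (intro mult_mono) auto
  moreover have "s * s < 1" using assms mult_strict_mono[of s 1 s 1] by simp
  ultimately have "(\<Sum>k. c k * (r * r) ^ k) \<le> (\<Sum>k. c k * (s * s) ^ k)"
    using assms(3) c(1) by (intro suminf_le c(2) mult_left_mono power_mono) auto
  then show ?thesis using assms eq[of r] eq[of s] by simp
qed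

lemma circle_mean_swap_radii:
  assumes "g holomorphic_on ball 0 1" "g \<in> borel_measurable borel"
    and "0 \<le> r" "r < 1" "0 \<le> s" "s < 1" "0 \<le> t" "t < 1" "t * t = r * s"
  shows "(\<integral>z. g (of_real r * z) * cnj (g (of_real s * z)) \<partial>circle)
       = (\<integral>z. g (of_real t * z) * cnj (g (of_real t * z)) \<partial>circle)"
proof -
  obtain c where
    "\<And>r s. 0 \<le> r \<Longrightarrow> r < 1 \<Longrightarrow> 0 \<le> s \<Longrightarrow> s < 1 \<Longrightarrow>
       (\<integral>z. g (of_real r * z) * cnj (g (of_real s * z)) \<partial>circle) = of_real (\<Sum>k. c k * (r * s) ^ k)"
    by (rule circle_mean_product[OF assms(1,2)]) (rule that)
  then show ?thesis using assms by simp
qed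

text \<open>Pairing with the geometric series with ratio \<open>cnj (w / r)\<close> recovers the value at \<open>w\<close>.
  The bound on the square comes from applying the reproducing formula to \<open>\<lambda>z. g z ^ 2\<close>.\<close>

lemma norm_square_le_circle_mean:
  assumes hol: "g holomorphic_on ball 0 1" and [measurable]: "g \<in> borel_measurable borel"
    and w: "norm w \<le> \<rho>" and \<rho>: "\<rho> < r" and r: "r < 1"
  shows "ennreal ((norm (g w))\<^sup>2)
     \<le> ennreal (r / (r - \<rho>)) * (\<integral>\<^sup>+z. ennreal ((norm (g (of_real r * z)))\<^sup>2) \<partial>circle)"
proof -
  have r0: "0 < r" using w \<rho> norm_ge_zero[of w] by linarith
  have hol2: "(\<lambda>z. g z ^ 2) holomorphic_on ball 0 1"
    by (intro holomorphic_intros hol)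
  obtain a where a: "\<And>z. norm z < 1 \<Longrightarrow> (\<lambda>k. a k * z ^ k) sums (g z ^ 2)"
    "\<And>z. norm z < 1 \<Longrightarrow> summable (\<lambda>k. norm (a k * z ^ k))"
    by (rule holomorphic_unit_disc_series[OF hol2]) (rule that)
  define q where "q = w / of_real r"
  have q: "norm q \<le> \<rho> / r" using w r0 by (simp add: q_def norm_divide divide_right_mono)
  have q1: "norm q < 1" using q by (rule order.strict_trans1) (use \<rho> r0 in simp)
  have sma: "summable (\<lambda>k. norm (a k * complex_of_real r ^ k))"
    using a(2)[of "of_real r"] r0 r by simp
  have smq: "summable (\<lambda>k. norm (cnj q ^ k))"
    using q1 by (simp add: norm_power summable_geometric)
  have "(\<integral>z. g (of_real r * z) ^ 2 * cnj (\<Sum>k. cnj q ^ k * z ^ k) \<partial>circle)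
      = (\<integral>z. (\<Sum>k. (a k * of_real r ^ k) * z ^ k) * cnj (\<Sum>k. cnj q ^ k * z ^ k) \<partial>circle)"
  proof (rule integral_cong_AE)
    show "AE z in circle. g (of_real r * z) ^ 2 * cnj (\<Sum>k. cnj q ^ k * z ^ k)
       = (\<Sum>k. (a k * of_real r ^ k) * z ^ k) * cnj (\<Sum>k. cnj q ^ k * z ^ k)"
      using AE_circle
    proof eventually_elim
      case (elim z)
      have "g (of_real r * z) ^ 2 = (\<Sum>k. (a k * of_real r ^ k) * z ^ k)"
        using a(1)[of "of_real r * z"] elim r0 r
        by (simp add: sums_iff norm_mult power_mult_distrib mult.assoc)
      then show ?case by simp
    qed
  qed measurable
  also have "\<dots> = (\<Sum>k. (a k * of_real r ^ k) * cnj (cnj q ^ k))"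
    by (rule integral_circle_series[OF sma smq])
  also have "\<dots> = (\<Sum>k. a k * w ^ k)"
    by (rule suminf_cong) (use r0 in \<open>simp add: q_def power_divide\<close>)
  also have "\<dots> = g w ^ 2"
    using a(1)[of w] w \<rho> r by (simp add: sums_iff)
  finally have eq: "(\<integral>z. g (of_real r * z) ^ 2 * cnj (\<Sum>k. cnj q ^ k * z ^ k) \<partial>circle) = g w ^ 2" .
  have bd: "AE z in circle. norm (g (of_real r * z) ^ 2 * cnj (\<Sum>k. cnj q ^ k * z ^ k))
      \<le> r / (r - \<rho>) * (norm (g (of_real r * z)))\<^sup>2"
    using AE_circle
  proof eventually_elim
    case (elim z)
    have "norm (\<Sum>k. cnj q ^ k * z ^ k) \<le> (\<Sum>k. norm q ^ k)"
      using summable_norm[of "\<lambda>k. cnj q ^ k * z ^ k"] elim q1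
      by (simp add: norm_mult norm_power summable_geometric)
    also have "\<dots> = 1 / (1 - norm q)" using q1 by (simp add: suminf_geometric)
    also have "\<dots> \<le> 1 / (1 - \<rho> / r)"
      using q \<rho> r0 by (intro divide_left_mono mult_pos_pos) (use q1 in auto)
    also have "\<dots> = r / (r - \<rho>)" using r0 \<rho> by (simp add: field_simps)
    finally have "norm (\<Sum>k. cnj q ^ k * z ^ k) \<le> r / (r - \<rho>)" .
    then show ?case
      by (simp only: norm_mult norm_power complex_mod_cnj mult.commute[of "r / (r - \<rho>)"])
         (rule mult_left_mono, auto)
  qed
  have "ennreal ((norm (g w))\<^sup>2) = ennreal (norm (g w ^ 2))" by (simp add: norm_power)
  also have "\<dots> \<le> (\<integral>\<^sup>+z. ennreal (norm (g (of_real r * z) ^ 2 * cnj (\<Sum>k. cnj q ^ k * z ^ k))) \<partial>circle)"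
  proof (cases "integrable circle (\<lambda>z. g (of_real r * z) ^ 2 * cnj (\<Sum>k. cnj q ^ k * z ^ k))")
    case True
    then show ?thesis unfolding eq[symmetric] by (rule integral_norm_bound_ennreal)
  next
    case False
    then show ?thesis unfolding eq[symmetric] by (simp add: not_integrable_integral_eq)
  qed
  also have "\<dots> \<le> (\<integral>\<^sup>+z. ennreal (r / (r - \<rho>)) * ennreal ((norm (g (of_real r * z)))\<^sup>2) \<partial>circle)"
  proof (rule nn_integral_mono_AE)
    have nn: "0 \<le> r / (r - \<rho>)" using r0 \<rho> by simp
    show "AE z in circle. ennreal (norm (g (of_real r * z) ^ 2 * cnj (\<Sum>k. cnj q ^ k * z ^ k)))
        \<le> ennreal (r / (r - \<rho>)) * ennreal ((norm (g (of_real r * z)))\<^sup>2)"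
      using bd
    proof eventually_elim
      case (elim z)
      then show ?case
        by (subst ennreal_mult[symmetric]) (use nn in \<open>auto intro: ennreal_leI\<close>)
    qed
  qed
  also have "\<dots> = ennreal (r / (r - \<rho>)) * (\<integral>\<^sup>+z. ennreal ((norm (g (of_real r * z)))\<^sup>2) \<partial>circle)"
    by (rule nn_integral_cmult) measurable
  finally show ?thesis .
qed

section \<open>The distinguished boundary as a product of circles\<close>

lemma space_torus_measure [simp]: "space torus_measure = UNIV"
  by (simp add: torus_measure_def)

lemma sets_torus_measure [simp, measurable_cong]: "sets torus_measure = sets borel"
  by (simp add: torus_measure_def)

interpretation torus: prob_space "torus_measure :: (complex ^ 'n::finite) measure"
  by (rule prob_space_torus_measure)

lemma prob_torus_UNIV [simp]: "measure torus_measure UNIV = 1"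
  using torus.prob_space by simp

lemma product_prob_space_circle: "product_prob_space (\<lambda>_. circle)"
  by (rule product_prob_spaceI) unfold_locales

lemma measurable_vec_lambda_PiM [measurable]:
  "vec_lambda \<in> borel_measurable (Pi\<^sub>M (UNIV :: 'n::finite set) (\<lambda>_. circle))"
proof (rule borel_measurable_euclidean_space[THEN iffD2], intro ballI)
  fix b :: "complex ^ 'n" assume "b \<in> Basis"
  then obtain i u where b: "b = axis i u" by (auto simp: Basis_vec_def)
  show "(\<lambda>t. vec_lambda t \<bullet> b) \<in> borel_measurable (Pi\<^sub>M (UNIV :: 'n::finite set) (\<lambda>_. circle))"
    by (simp add: b inner_axis)
qed

lemma torus_measure_eq:
  "torus_measure = distr (Pi\<^sub>M (UNIV :: 'n::finite set) (\<lambda>_. circle)) borel vec_lambda"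
proof -
  let ?U = "uniform_measure lborel {0..2 * pi} :: real measure"
  have [measurable]: "cis \<in> measurable ?U circle"
    by (simp cong: measurable_cong_sets)
  have "circle = distr ?U circle cis"
    unfolding circle_def by (rule distr_cong) simp_all
  then have "Pi\<^sub>M (UNIV :: 'n set) (\<lambda>_. circle) = Pi\<^sub>M UNIV (\<lambda>_. distr ?U circle cis)"
    by simp
  also have "\<dots> = distr (Pi\<^sub>M UNIV (\<lambda>_. ?U)) (Pi\<^sub>M UNIV (\<lambda>_. circle)) (compose UNIV cis)"
    by (rule distr_PiM_finite_prob_space'[symmetric])
       (auto intro: prob_space_arc circle.prob_space_axioms)
  finally have eq: "Pi\<^sub>M (UNIV :: 'n set) (\<lambda>_. circle) = \<dots>" .
  have [measurable]: "compose UNIV cis \<in> measurable (Pi\<^sub>M (UNIV :: 'n set) (\<lambda>_. ?U)) (Pi\<^sub>M UNIV (\<lambda>_. circle))"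
    unfolding compose_def restrict_UNIV
    by (rule measurable_PiM_single') (auto simp: space_PiM cong: measurable_cong_sets)
  show ?thesis
    unfolding torus_measure_def
    by (subst eq, subst distr_distr) (auto simp: comp_def compose_def restrict_UNIV)
qed

lemma AE_torus: "AE z :: complex ^ 'n::finite in torus_measure. \<forall>i. norm (z $ i) = 1"
proof -
  interpret P: product_prob_space "\<lambda>_::'n. circle" UNIV by (rule product_prob_space_circle)
  have "AE t in Pi\<^sub>M (UNIV :: 'n::finite set) (\<lambda>_. circle). norm (t i) = 1" for i
    by (rule AE_PiM_component) (auto intro: circle.prob_space_axioms AE_circle)
  then have "AE t in Pi\<^sub>M (UNIV :: 'n::finite set) (\<lambda>_. circle). \<forall>i. norm (t i) = 1"
    by (simp add: AE_all_countable)
  moreover have "{z :: complex ^ 'n. \<forall>i. norm (z $ i) = 1} \<in> sets borel"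
    by (intro borel_closed closed_Collect_all closed_Collect_eq continuous_intros)
  ultimately show ?thesis
    unfolding torus_measure_eq by (subst AE_distr_iff) auto
qed

lemma measurable_scale_vec [measurable]:
  "(*s) (w::complex) \<in> borel_measurable (borel :: (complex ^ 'n::finite) measure)"
  unfolding vector_scalar_mult_def
  by (intro borel_measurable_continuous_onI continuous_intros)

lemma distr_torus_mult:
  assumes w: "norm w = 1"
  shows "distr torus_measure borel ((*s) w) = (torus_measure :: (complex ^ 'n::finite) measure)"
proof -
  let ?P = "Pi\<^sub>M (UNIV :: 'n set) (\<lambda>_. circle)"
  have [measurable]: "(*) w \<in> measurable circle circle"
    by (simp cong: measurable_cong_sets)
  have [measurable]: "compose UNIV ((*) w) \<in> measurable ?P ?P"
    unfolding compose_def restrict_UNIV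
    by (rule measurable_PiM_single') (auto simp: space_PiM cong: measurable_cong_sets)
  have "circle = distr circle circle ((*) w)"
    by (subst distr_circle_mult[OF w, symmetric], rule distr_cong) simp_all
  then have "?P = Pi\<^sub>M (UNIV :: 'n set) (\<lambda>_. distr circle circle ((*) w))"
    by simp
  also have "\<dots> = distr ?P ?P (compose UNIV ((*) w))"
    by (rule distr_PiM_finite_prob_space'[symmetric]) (auto intro: circle.prob_space_axioms)
  finally have eq: "?P = distr ?P ?P (compose UNIV ((*) w))" .
  have "distr torus_measure borel ((*s) w) = distr ?P borel ((*s) w \<circ> vec_lambda)"
    unfolding torus_measure_eq by (rule distr_distr) measurable
  also have "(*s) w \<circ> vec_lambda = vec_lambda \<circ> compose (UNIV :: 'n set) ((*) w)"
    by (auto simp: fun_eq_iff vec_eq_iff compose_def)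
  also have "distr ?P borel (vec_lambda \<circ> compose (UNIV :: 'n set) ((*) w))
      = distr (distr ?P ?P (compose UNIV ((*) w))) borel vec_lambda"
    by (rule distr_distr[symmetric]) measurable
  also have "\<dots> = torus_measure"
    unfolding eq[symmetric] torus_measure_eq ..
  finally show ?thesis .
qed

text \<open>Rotating all coordinates by the same angle preserves the measure, so a torus mean is
  a mean over circles through the origin.\<close>

lemma integral_torus_slices:
  fixes G :: "complex ^ 'n::finite \<Rightarrow> complex"
  assumes [measurable]: "G \<in> borel_measurable borel"
    and B: "\<And>z. (\<And>i. norm (z $ i) = 1) \<Longrightarrow> norm (G z) \<le> B"
  shows "(\<integral>z. G z \<partial>torus_measure) = (\<integral>z. (\<integral>w. G (w *s z) \<partial>circle) \<partial>torus_measure)"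
proof -
  interpret P: pair_prob_space circle "torus_measure :: (complex ^ 'n) measure"
    by unfold_locales
  have c[measurable]: "(\<lambda>x. fst x *s snd x :: complex ^ 'n) \<in> borel_measurable (borel \<Otimes>\<^sub>M borel)"
    unfolding borel_prod vector_scalar_mult_def
    by (intro borel_measurable_continuous_onI continuous_intros)
  have m[measurable]: "(\<lambda>(w, z). G (w *s z)) \<in> borel_measurable (circle \<Otimes>\<^sub>M torus_measure)"
    using measurable_compose[OF c assms(1)] by (simp add: case_prod_beta cong: measurable_cong_sets)
  have "(\<integral>z. (\<integral>w. G (w *s z) \<partial>circle) \<partial>torus_measure) = (\<integral>w. (\<integral>z. G (w *s z) \<partial>torus_measure) \<partial>circle)"
  proof (rule P.Fubini_integral)
    have "AE x :: complex \<times> (complex ^ 'n) in circle \<Otimes>\<^sub>M torus_measure. norm (fst x) = 1 \<and> (\<forall>i. norm (snd x $ i) = (1::real))"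
    proof (rule P.AE_pair_measure)
      show "AE w in circle. AE z :: complex ^ 'n in torus_measure.
          norm (fst (w, z)) = 1 \<and> (\<forall>i. norm (snd (w, z) $ i) = (1::real))"
        using AE_circle by eventually_elim (use AE_torus in simp)
      have "{x :: complex \<times> (complex ^ 'n). norm (fst x) = 1 \<and> (\<forall>i. norm (snd x $ i) = 1)} \<in> sets borel"
        by (intro borel_closed closed_Collect_conj closed_Collect_all closed_Collect_eq continuous_intros)
      moreover have "sets (circle \<Otimes>\<^sub>M torus_measure) = sets (borel :: (complex \<times> (complex ^ 'n)) measure)"
        unfolding borel_prod[symmetric] by (intro sets_pair_measure_cong) simp_all
      ultimately show "{x \<in> space (circle \<Otimes>\<^sub>M torus_measure).
          norm (fst x) = 1 \<and> (\<forall>i. norm (snd x $ i :: complex) = 1)}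
          \<in> sets (circle \<Otimes>\<^sub>M (torus_measure :: (complex ^ 'n) measure))"
        by (simp add: space_pair_measure)
    qed
    then have "AE x in circle \<Otimes>\<^sub>M torus_measure. norm (G (fst x *s snd x)) \<le> B"
      by eventually_elim (intro B, simp add: norm_mult)
    then show "integrable (circle \<Otimes>\<^sub>M torus_measure) (\<lambda>(w, z). G (w *s z))"
      by (intro P.integrable_const_bound[where B=B]) (auto simp: case_prod_beta)
  qed
  also have "\<dots> = (\<integral>w. (\<integral>z. G z \<partial>torus_measure) \<partial>circle)"
  proof (rule integral_cong_AE)
    show "AE w in circle. (\<integral>z. G (w *s z) \<partial>torus_measure) = (\<integral>z. G z \<partial>torus_measure)"
      using AE_circle
    proof eventually_elim
      case (elim w)
      have "(\<integral>z. G z \<partial>torus_measure) = (\<integral>z. G z \<partial>distr torus_measure borel ((*s) w))"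
        by (simp add: distr_torus_mult[OF elim])
      also have "\<dots> = (\<integral>z. G (w *s z) \<partial>torus_measure)"
        by (rule integral_distr) measurable
      finally show ?case ..
    qed
    show "(\<lambda>w. \<integral>z. G (w *s z) \<partial>torus_measure) \<in> borel_measurable circle"
      by (rule torus.borel_measurable_lebesgue_integral) (use m in simp)
  qed simp
  finally show ?thesis by simp
qed

section \<open>Analytic functions on the polydisc\<close>

text \<open>The extension by zero makes these functions Borel measurable on the whole space
  (\<open>analytic_borel_measurable\<close>), as integration over tori of radius less than 1 requires.\<close>

definition analytic_functions :: "(complex ^ 'n::finite \<Rightarrow> complex) set" where
  "analytic_functions = {f. analytic_several_on f polydisc \<and> (\<forall>z. z \<notin> polydisc \<longrightarrow> f z = 0)}"

lemma open_polydisc: "open (polydisc :: (complex ^ 'n::finite) set)"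
proof -
  have "polydisc = (\<Inter>i. {z :: complex ^ 'n. norm (z $ i) < 1})"
    by (auto simp: polydisc_def)
  also have "open \<dots>"
    by (intro open_INT ballI open_Collect_less continuous_intros) simp
  finally show ?thesis .
qed

lemma analytic_continuous_on: "f \<in> analytic_functions \<Longrightarrow> continuous_on polydisc f"
  unfolding analytic_functions_def analytic_several_on_def
  by (blast intro: continuous_at_imp_continuous_on has_derivative_continuous)

lemma analytic_borel_measurable [measurable_dest]:
  assumes "f \<in> analytic_functions"
  shows "f \<in> borel_measurable borel"
proof -
  have "(\<lambda>z. indicator polydisc z *\<^sub>R f z) \<in> borel_measurable borel"
    by (rule borel_measurable_continuous_on_indicator)
       (auto intro: analytic_continuous_on assms borel_open[OF open_polydisc])
  also have "(\<lambda>z. indicator polydisc z *\<^sub>R f z) = f"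
    using assms by (auto simp: fun_eq_iff indicator_def analytic_functions_def)
  finally show ?thesis .
qed

lemma has_field_derivative_along_line:
  fixes f :: "complex ^ 'n::finite \<Rightarrow> complex"
  assumes f: "(f has_derivative D) (at (a + w *s v))" and D: "\<And>c u. D (c *s u) = c * D u"
  shows "((\<lambda>w. f (a + w *s v)) has_field_derivative D v) (at w)"
proof -
  have "linear (\<lambda>w::complex. w *s v)"
    by (intro linearI) (auto simp: vec_eq_iff algebra_simps)
  then have bl: "bounded_linear (\<lambda>w::complex. w *s v)"
    by (simp add: linear_conv_bounded_linear)
  have "((\<lambda>w. a + w *s v) has_derivative (\<lambda>w. w *s v)) (at w)"
    using has_derivative_add[OF has_derivative_const bounded_linear.has_derivative[OF bl has_derivative_ident]]
    by simp
  from has_derivative_compose[OF this f] show ?thesis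
    by (simp add: has_field_derivative_def D mult.commute[of _ "D v"])
qed

lemma analytic_on_complex_line:
  assumes f: "f \<in> analytic_functions" and S: "open S" "\<And>w. w \<in> S \<Longrightarrow> a + w *s v \<in> polydisc"
  shows "(\<lambda>w. f (a + w *s v)) holomorphic_on S"
proof (rule holomorphic_onI)
  fix w assume w: "w \<in> S"
  obtain D where "(f has_derivative D) (at (a + w *s v))" "\<And>c u. D (c *s u) = c * D u"
    using f S(2)[OF w] unfolding analytic_functions_def analytic_several_on_def by blast
  then have "((\<lambda>w. f (a + w *s v)) has_field_derivative D v) (at w)"
    by (rule has_field_derivative_along_line)
  then show "(\<lambda>w. f (a + w *s v)) field_differentiable at w within S"
    by (meson field_differentiable_def field_differentiable_at_within)
qed

lemma analytic_bounded_on_subdisc: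
  fixes f :: "complex ^ 'n::finite \<Rightarrow> complex"
  assumes f: "f \<in> analytic_functions" and r: "r < 1"
  obtains B where "0 \<le> B" "\<And>z. (\<And>i. norm (z $ i) \<le> r) \<Longrightarrow> norm (f z) \<le> B"
proof -
  define K where "K = {z :: complex ^ 'n. \<forall>i. norm (z $ i) \<le> r}"
  have "closed K" unfolding K_def
    by (intro closed_Collect_all closed_Collect_le continuous_intros)
  moreover have "bounded K"
  proof (rule boundedI)
    fix z assume z: "z \<in> K"
    then have "norm (z $ i) \<le> norm ((\<chi> i. complex_of_real r) $ i)" for i
      unfolding K_def using abs_ge_self[of r] order_trans by fastforce
    then show "norm z \<le> norm (\<chi> i::'n. complex_of_real r)"
      by (rule norm_le_componentwise_cart)
  qed
  ultimately have "compact K" by (simp add: compact_eq_bounded_closed)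
  moreover have "K \<subseteq> polydisc" unfolding K_def polydisc_def using r by (auto intro: order.strict_trans1)
  ultimately have "compact (f ` K)"
    using analytic_continuous_on[OF f] by (meson compact_continuous_image continuous_on_subset)
  then obtain B where "B > 0" "\<forall>x\<in>f ` K. norm x \<le> B"
    using compact_imp_bounded bounded_pos by blast
  then show ?thesis by (intro that[of B]) (auto simp: K_def)
qed

lemma analytic_bounded_on_torus:
  fixes f :: "complex ^ 'n::finite \<Rightarrow> complex"
  assumes f: "f \<in> analytic_functions" and r: "0 \<le> r" "r < 1"
  obtains B where "0 \<le> B" "\<And>z. (\<And>i. norm (z $ i) = 1) \<Longrightarrow> norm (f (r *\<^sub>R z)) \<le> B"
proof -
  obtain B where B: "0 \<le> B" "\<And>z. (\<And>i. norm (z $ i) \<le> r) \<Longrightarrow> norm (f z) \<le> B"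
    using analytic_bounded_on_subdisc[OF f r(2)] by blast
  show ?thesis
    by (rule that[OF B(1)], rule B(2)) (use r in simp)
qed

section \<open>Means over the torus\<close>

lemma integrable_torus_product:
  fixes f g :: "complex ^ 'n::finite \<Rightarrow> complex"
  assumes fg: "f \<in> analytic_functions" "g \<in> analytic_functions" and r: "0 \<le> r" "r < 1" and s: "0 \<le> s" "s < 1"
  shows "integrable torus_measure (\<lambda>z. f (r *\<^sub>R z) * cnj (g (s *\<^sub>R z)))"
proof -
  obtain B where B: "0 \<le> B" "\<And>z. (\<And>i. norm (z $ i) = 1) \<Longrightarrow> norm (f (r *\<^sub>R z)) \<le> B"
    using analytic_bounded_on_torus[OF fg(1) r] by blast
  obtain C where C: "0 \<le> C" "\<And>z. (\<And>i. norm (z $ i) = 1) \<Longrightarrow> norm (g (s *\<^sub>R z)) \<le> C"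
    using analytic_bounded_on_torus[OF fg(2) s] by blast
  have [measurable]: "f \<in> borel_measurable borel" "g \<in> borel_measurable borel"
    using fg by measurable
  show ?thesis
  proof (rule torus.integrable_const_bound)
    show "AE z in torus_measure. norm (f (r *\<^sub>R z) * cnj (g (s *\<^sub>R z))) \<le> B * C"
      using AE_torus
      by eventually_elim (auto simp: norm_mult intro!: mult_mono B C)
  qed measurable
qed

lemma integrable_torus_square:
  assumes "f \<in> analytic_functions" "0 \<le> r" "r < 1"
  shows "integrable torus_measure (\<lambda>z. (norm (f (r *\<^sub>R z)))\<^sup>2)"
proof -
  have "integrable torus_measure (\<lambda>z. complex_of_real ((norm (f (r *\<^sub>R z)))\<^sup>2))"
    unfolding complex_norm_square by (rule integrable_torus_product) (use assms in auto)
  from integrable_Re[OF this] show ?thesis by simp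
qed

lemma integral_torus_square:
  assumes "f \<in> analytic_functions" "0 \<le> r" "r < 1"
  shows "(\<integral>z. f (r *\<^sub>R z) * cnj (f (r *\<^sub>R z)) \<partial>torus_measure)
      = of_real (\<integral>z. (norm (f (r *\<^sub>R z)))\<^sup>2 \<partial>torus_measure)"
  unfolding complex_norm_square[symmetric] by (rule integral_complex_of_real)

lemma
  fixes f :: "complex ^ 'n::finite \<Rightarrow> complex" and z :: "complex ^ 'n"
  assumes f: "f \<in> analytic_functions" and z: "\<And>i. norm (z $ i) = 1"
  shows slice_holomorphic: "(\<lambda>w. f (w *s z)) holomorphic_on ball 0 1"
    and slice_measurable: "(\<lambda>w. f (w *s z)) \<in> borel_measurable borel"
proof -
  show "(\<lambda>w. f (w *s z)) holomorphic_on ball 0 1"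
  proof -
    have "(\<lambda>w. f (0 + w *s z)) holomorphic_on ball 0 1"
      by (rule analytic_on_complex_line[OF f open_ball]) (use z in \<open>simp add: polydisc_def norm_mult\<close>)
    then show ?thesis by simp
  qed
  have "(\<lambda>w. w *s z) \<in> borel_measurable borel"
    unfolding vector_scalar_mult_def
    by (intro borel_measurable_continuous_onI continuous_intros)
  from measurable_compose[OF this analytic_borel_measurable[OF f]]
  show "(\<lambda>w. f (w *s z)) \<in> borel_measurable borel" .
qed

lemma measurable_slices [measurable]:
  fixes f :: "complex ^ 'n::finite \<Rightarrow> complex"
  assumes "f \<in> analytic_functions"
  shows "(\<lambda>x. f ((c * snd x) *s fst x)) \<in> borel_measurable (torus_measure \<Otimes>\<^sub>M circle)"
proof -
  have "(\<lambda>x :: (complex ^ 'n) \<times> complex. (c * snd x) *s fst x) \<in> borel_measurable (borel \<Otimes>\<^sub>M borel)"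
    unfolding borel_prod vector_scalar_mult_def
    by (intro borel_measurable_continuous_onI continuous_intros)
  from measurable_compose[OF this analytic_borel_measurable[OF assms]] show ?thesis
    by (simp cong: measurable_cong_sets)
qed

lemma measurable_slice_means:
  fixes f :: "complex ^ 'n::finite \<Rightarrow> complex"
  assumes f: "f \<in> analytic_functions"
  shows "(\<lambda>z. \<integral>w. f ((c * w) *s z) * cnj (f ((d * w) *s z)) \<partial>circle) \<in> borel_measurable torus_measure"
    and "(\<lambda>z. \<integral>w. (norm (f ((c * w) *s z)))\<^sup>2 \<partial>circle) \<in> borel_measurable torus_measure"
proof -
  have "(\<lambda>(z, w). f ((c * w) *s z) * cnj (f ((d * w) *s z))) \<in> borel_measurable (torus_measure \<Otimes>\<^sub>M circle)"
    "(\<lambda>(z, w). (norm (f ((c * w) *s z)))\<^sup>2) \<in> borel_measurable (torus_measure \<Otimes>\<^sub>M circle)"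
    unfolding case_prod_beta using f by measurable
  from this[THEN circle.borel_measurable_lebesgue_integral]
  show "(\<lambda>z. \<integral>w. f ((c * w) *s z) * cnj (f ((d * w) *s z)) \<partial>circle) \<in> borel_measurable torus_measure"
    "(\<lambda>z. \<integral>w. (norm (f ((c * w) *s z)))\<^sup>2 \<partial>circle) \<in> borel_measurable torus_measure" .
qed

lemma torus_product_slices:
  fixes f :: "complex ^ 'n::finite \<Rightarrow> complex"
  assumes f: "f \<in> analytic_functions" and r: "0 \<le> r" "r < 1" and s: "0 \<le> s" "s < 1"
  shows "(\<integral>z. f (r *\<^sub>R z) * cnj (f (s *\<^sub>R z)) \<partial>torus_measure)
    = (\<integral>z. (\<integral>w. f ((of_real r * w) *s z) * cnj (f ((of_real s * w) *s z)) \<partial>circle) \<partial>torus_measure)"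
proof -
  obtain B where B: "0 \<le> B" "\<And>z. (\<And>i. norm (z $ i) = 1) \<Longrightarrow> norm (f (r *\<^sub>R z)) \<le> B"
    using analytic_bounded_on_torus[OF f r] by blast
  obtain C where C: "0 \<le> C" "\<And>z. (\<And>i. norm (z $ i) = 1) \<Longrightarrow> norm (f (s *\<^sub>R z)) \<le> C"
    using analytic_bounded_on_torus[OF f s] by blast
  have [measurable]: "f \<in> borel_measurable borel" using f by measurable
  have sc: "t *\<^sub>R (w *s z) = (of_real t * w) *s z" for t w and z :: "complex ^ 'n"
    by (simp only: vec_eq_iff vector_scaleR_component vector_smult_component)
        (simp add: scaleR_conv_of_real mult.assoc)
  show ?thesis
    by (subst integral_torus_slices[where B="B * C"])
       (auto simp: norm_mult sc intro!: mult_mono B C)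
qed

text \<open>On each slice, the mean of \<open>f (r z) * cnj (f (s z))\<close> depends on the product of the
  radii only.\<close>

lemma torus_mean_swap_radii:
  fixes f :: "complex ^ 'n::finite \<Rightarrow> complex"
  assumes f: "f \<in> analytic_functions" and r: "0 \<le> r" "r < 1" and s: "0 \<le> s" "s < 1"
    and t: "0 \<le> t" "t < 1" "t * t = r * s"
  shows "(\<integral>z. f (r *\<^sub>R z) * cnj (f (s *\<^sub>R z)) \<partial>torus_measure)
      = of_real (\<integral>z. (norm (f (t *\<^sub>R z)))\<^sup>2 \<partial>torus_measure)"
  unfolding integral_torus_square[OF f t(1,2), symmetric]
    torus_product_slices[OF f r s] torus_product_slices[OF f t(1,2) t(1,2)]
proof (rule integral_cong_AE)
  show "AE z in torus_measure.
      (\<integral>w. f ((of_real r * w) *s z) * cnj (f ((of_real s * w) *s z)) \<partial>circle)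
    = (\<integral>w. f ((of_real t * w) *s z) * cnj (f ((of_real t * w) *s z)) \<partial>circle)"
    using AE_torus
  proof eventually_elim
    case (elim z)
    show ?case
      by (rule circle_mean_swap_radii[of "\<lambda>w. f (w *s z)"])
         (use elim in \<open>auto intro!: slice_holomorphic slice_measurable f r s t\<close>)
  qed
qed (rule measurable_slice_means[OF f])+

text \<open>Monotonicity on each slice is inherited by the integral over all slices.\<close>

lemma torus_mean_mono:
  fixes f :: "complex ^ 'n::finite \<Rightarrow> complex"
  assumes f: "f \<in> analytic_functions" and r: "0 \<le> r" "r \<le> s" "s < 1"
  shows "(\<integral>z. (norm (f (r *\<^sub>R z)))\<^sup>2 \<partial>torus_measure) \<le> (\<integral>z. (norm (f (s *\<^sub>R z)))\<^sup>2 \<partial>torus_measure)"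
proof -
  define M where "M t z = (\<integral>w. (norm (f ((of_real t * w) *s z)))\<^sup>2 \<partial>circle)" for t z
  have [measurable]: "f \<in> borel_measurable borel" using f by measurable
  have M: "(\<integral>z. (norm (f (t *\<^sub>R z)))\<^sup>2 \<partial>torus_measure) = (\<integral>z. M t z \<partial>torus_measure)"
    "integrable torus_measure (M t)" if t: "0 \<le> t" "t < 1" for t
  proof -
    have "complex_of_real (M t z)
        = (\<integral>w. f ((of_real t * w) *s z) * cnj (f ((of_real t * w) *s z)) \<partial>circle)" for z
      unfolding M_def complex_norm_square[symmetric] by (rule integral_complex_of_real[symmetric])
    then have "complex_of_real (\<integral>z. (norm (f (t *\<^sub>R z)))\<^sup>2 \<partial>torus_measure)
        = of_real (\<integral>z. M t z \<partial>torus_measure)"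
      unfolding integral_torus_square[OF f t, symmetric] torus_product_slices[OF f t t]
      by (simp flip: integral_complex_of_real)
    then show "(\<integral>z. (norm (f (t *\<^sub>R z)))\<^sup>2 \<partial>torus_measure) = (\<integral>z. M t z \<partial>torus_measure)"
      by (simp only: of_real_eq_iff)
    obtain B where B: "0 \<le> B" "\<And>z. (\<And>i. norm (z $ i) = 1) \<Longrightarrow> norm (f (t *\<^sub>R z)) \<le> B"
      using analytic_bounded_on_torus[OF f t] by blast
    show "integrable torus_measure (M t)"
    proof (rule torus.integrable_const_bound[where B="B\<^sup>2"])
      show "AE z in torus_measure. norm (M t z) \<le> B\<^sup>2"
        using AE_torus
      proof eventually_elim
        case (elim z)
        have bd: "AE w in circle. (norm (f ((of_real t * w) *s z)))\<^sup>2 \<le> B\<^sup>2"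
          using AE_circle
        proof eventually_elim
          case (elim w)
          have "(of_real t * w) *s z = t *\<^sub>R (w *s z)"
            by (simp only: vec_eq_iff vector_scaleR_component vector_smult_component)
        (simp add: scaleR_conv_of_real mult.assoc)
          then show ?case
            using B(2)[of "w *s z"] elim \<open>\<forall>i. norm (z $ i) = 1\<close>
            by (simp add: norm_mult power_mono)
        qed
        have [measurable]: "(\<lambda>w. f (w *s z)) \<in> borel_measurable borel"
          using elim by (intro slice_measurable f) auto
        have "integrable circle (\<lambda>w. (norm (f ((of_real t * w) *s z)))\<^sup>2)"
          by (rule circle.integrable_const_bound[where B="B\<^sup>2"])
             (use bd in \<open>simp, measurable\<close>)
        then have "M t z \<le> B\<^sup>2"
          unfolding M_def using bd by (rule circle.integral_le_const)
        then show ?case by (simp add: M_def)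
      qed
      show "M t \<in> borel_measurable torus_measure"
        unfolding M_def by (rule measurable_slice_means[OF f])
    qed
  qed
  have "(\<integral>z. M r z \<partial>torus_measure) \<le> (\<integral>z. M s z \<partial>torus_measure)"
  proof (rule integral_mono_AE)
    show "AE z in torus_measure. M r z \<le> M s z"
      using AE_torus
    proof eventually_elim
      case (elim z)
      show ?case
        unfolding M_def
        by (rule circle_mean_mono[of "\<lambda>w. f (w *s z)"])
           (use elim r in \<open>auto intro!: slice_holomorphic slice_measurable f\<close>)
    qed
  qed (use M r in auto)
  then show ?thesis using M r by simp
qed

text \<open>The one-variable estimate \<open>norm_square_le_circle_mean\<close> is applied in one coordinate after the
  other: in \<open>p I t\<close> the coordinates in \<open>I\<close> have already been moved to the circle of radius \<open>r\<close>.\<close>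

lemma analytic_point_bound:
  fixes f :: "complex ^ 'n::finite \<Rightarrow> complex" and w :: "complex ^ 'n"
  assumes f: "f \<in> analytic_functions" and w: "\<And>i. norm (w $ i) \<le> \<rho>" and \<rho>: "\<rho> < r" and r: "r < 1"
  shows "(norm (f w))\<^sup>2 \<le> (r / (r - \<rho>)) ^ CARD('n) * (\<integral>z. (norm (f (r *\<^sub>R z)))\<^sup>2 \<partial>torus_measure)"
proof -
  have [measurable]: "f \<in> borel_measurable borel" using f by measurable
  have r0: "0 < r" using w[of undefined] \<rho> norm_ge_zero[of "w $ undefined"] by linarith
  define C where "C = r / (r - \<rho>)"
  have C: "0 \<le> C" using r0 \<rho> by (simp add: C_def)
  interpret P: product_prob_space "\<lambda>_::'n. circle" UNIV by (rule product_prob_space_circle)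
  define p where "p I t = (\<chi> i. if i \<in> I then of_real r * t i else w $ i)" for I :: "'n set" and t
  have p[measurable]: "p I \<in> borel_measurable (Pi\<^sub>M I (\<lambda>_. circle))" for I
  proof (rule borel_measurable_euclidean_space[THEN iffD2], intro ballI)
    fix b :: "complex ^ 'n" assume "b \<in> Basis"
    then obtain i u where b: "b = axis i u" by (auto simp: Basis_vec_def)
    show "(\<lambda>t. p I t \<bullet> b) \<in> borel_measurable (Pi\<^sub>M I (\<lambda>_. circle))"
      by (cases "i \<in> I") (simp_all add: b inner_axis p_def)
  qed
  have "ennreal ((norm (f w))\<^sup>2)
      \<le> ennreal C ^ card I * (\<integral>\<^sup>+t. ennreal ((norm (f (p I t)))\<^sup>2) \<partial>Pi\<^sub>M I (\<lambda>_. circle))" for I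
  proof (induction I rule: finite_induct[OF finite])
    case 1
    interpret E: prob_space "Pi\<^sub>M {} (\<lambda>_::'n. circle)"
      by (rule prob_space_PiM) (rule circle.prob_space_axioms)
    show ?case using E.emeasure_space_1 by (simp add: p_def)
  next
    case (2 j I)
    have "(\<integral>\<^sup>+t. ennreal ((norm (f (p I t)))\<^sup>2) \<partial>Pi\<^sub>M I (\<lambda>_. circle))
       \<le> (\<integral>\<^sup>+t. ennreal C * (\<integral>\<^sup>+y. ennreal ((norm (f (p (insert j I) (t(j := y)))))\<^sup>2) \<partial>circle) \<partial>Pi\<^sub>M I (\<lambda>_. circle))"
    proof (rule nn_integral_mono_AE)
      have "AE t in Pi\<^sub>M I (\<lambda>_. circle). \<forall>i\<in>I. norm (t i) = 1"
        by (intro AE_finite_allI 2 AE_PiM_component) (auto intro: circle.prob_space_axioms AE_circle)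
      then show "AE t in Pi\<^sub>M I (\<lambda>_. circle). ennreal ((norm (f (p I t)))\<^sup>2)
         \<le> ennreal C * (\<integral>\<^sup>+y. ennreal ((norm (f (p (insert j I) (t(j := y)))))\<^sup>2) \<partial>circle)"
      proof eventually_elim
        case (elim t)
        define a where "a = (\<chi> i. if i = j then 0 else p I t $ i)"
        define g where "g x = f (a + x *s axis j 1)" for x
        have gp: "p I t = a + (w $ j) *s axis j 1"
          "p (insert j I) (t(j := y)) = a + (of_real r * y) *s axis j 1" for y
          using \<open>j \<notin> I\<close> by (auto simp: a_def p_def vec_eq_iff axis_def)
        have "(\<lambda>x::complex. a + x *s axis j 1) \<in> borel_measurable borel"
          unfolding vector_scalar_mult_def
          by (intro borel_measurable_continuous_onI continuous_intros)
        then have gm: "g \<in> borel_measurable borel"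
          unfolding g_def by (rule measurable_compose) measurable
        have "norm (w $ i) < 1" for i using w[of i] \<rho> r by linarith
        then have "a + x *s axis j 1 \<in> polydisc" if "x \<in> ball 0 1" for x
          using that elim r r0 by (auto simp: a_def p_def polydisc_def axis_def norm_mult)
        then have gh: "g holomorphic_on ball 0 1"
          unfolding g_def by (intro analytic_on_complex_line f) auto
        show ?case
          using norm_square_le_circle_mean[OF gh gm w[of j] \<rho> r]
          by (simp add: g_def gp C_def)
      qed
    qed
    also have "\<dots> = ennreal C * (\<integral>\<^sup>+t. (\<integral>\<^sup>+y. ennreal ((norm (f (p (insert j I) (t(j := y)))))\<^sup>2) \<partial>circle) \<partial>Pi\<^sub>M I (\<lambda>_. circle))"
    proof (rule nn_integral_cmult)
      have "(\<lambda>x. p (insert j I) ((fst x)(j := snd x))) \<in> borel_measurable (Pi\<^sub>M I (\<lambda>_. circle) \<Otimes>\<^sub>M circle)"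
        using measurable_compose[OF measurable_add_dim p] by (simp add: case_prod_beta)
      then have "(\<lambda>(t, y). ennreal ((norm (f (p (insert j I) (t(j := y)))))\<^sup>2)) \<in> borel_measurable (Pi\<^sub>M I (\<lambda>_. circle) \<Otimes>\<^sub>M circle)"
        by (simp add: case_prod_beta)
      then show "(\<lambda>t. \<integral>\<^sup>+y. ennreal ((norm (f (p (insert j I) (t(j := y)))))\<^sup>2) \<partial>circle) \<in> borel_measurable (Pi\<^sub>M I (\<lambda>_. circle))"
        by (rule circle.borel_measurable_nn_integral)
    qed
    also have "\<dots> = ennreal C * (\<integral>\<^sup>+t. ennreal ((norm (f (p (insert j I) t)))\<^sup>2) \<partial>Pi\<^sub>M (insert j I) (\<lambda>_. circle))"
      using 2 by (subst P.product_nn_integral_insert) auto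
    finally have "ennreal C ^ card I * (\<integral>\<^sup>+t. ennreal ((norm (f (p I t)))\<^sup>2) \<partial>Pi\<^sub>M I (\<lambda>_. circle))
       \<le> ennreal C ^ card I * (ennreal C * (\<integral>\<^sup>+t. ennreal ((norm (f (p (insert j I) t)))\<^sup>2) \<partial>Pi\<^sub>M (insert j I) (\<lambda>_. circle)))"
      by (rule mult_left_mono) simp
    from order_trans[OF 2(3) this] show ?case
      using 2(1,2) by (simp add: ac_simps)
  qed
  from this[of UNIV] have "ennreal ((norm (f w))\<^sup>2)
      \<le> ennreal C ^ CARD('n) * (\<integral>\<^sup>+t. ennreal ((norm (f (r *\<^sub>R vec_lambda t)))\<^sup>2) \<partial>Pi\<^sub>M UNIV (\<lambda>_. circle))"
    by (simp add: p_def scaleR_vec_def scaleR_conv_of_real)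
  also have "\<dots> = ennreal C ^ CARD('n) * (\<integral>\<^sup>+z. ennreal ((norm (f (r *\<^sub>R z)))\<^sup>2) \<partial>torus_measure)"
    unfolding torus_measure_eq by (subst nn_integral_distr) auto
  also have "\<dots> = ennreal C ^ CARD('n) * ennreal (\<integral>z. (norm (f (r *\<^sub>R z)))\<^sup>2 \<partial>torus_measure)"
    using r0 r by (subst nn_integral_eq_integral) (auto intro: integrable_torus_square f)
  finally show ?thesis
    using C by (simp add: ennreal_power ennreal_mult[symmetric] C_def)
qed

section \<open>Norm and inner product of the Hardy space\<close>

definition square_mean :: "(complex ^ 'n::finite \<Rightarrow> complex) \<Rightarrow> real \<Rightarrow> real" where
  "square_mean f r = (\<integral>z. (norm (f (r *\<^sub>R z)))\<^sup>2 \<partial>torus_measure)"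

lemma H2_eq: "H2 = {f \<in> analytic_functions. bdd_above (square_mean f ` {0..<1})}"
  by (auto simp: H2_def analytic_functions_def square_mean_def)

lemma H2_analytic: "f \<in> H2 \<Longrightarrow> f \<in> analytic_functions"
  by (simp add: H2_eq)

lemma H2_I:
  assumes "f \<in> analytic_functions" "\<And>r. 0 \<le> r \<Longrightarrow> r < 1 \<Longrightarrow> square_mean f r \<le> B"
  shows "f \<in> H2"
  using assms by (auto simp: H2_eq intro!: bdd_aboveI2[where M=B])

lemma square_mean_nonneg: "0 \<le> square_mean f r"
  by (simp add: square_mean_def)

lemma SUP_square_mean_nonneg:
  assumes "f \<in> H2"
  shows "0 \<le> (SUP r\<in>{0..<1}. square_mean f r)"
proof (rule cSUP_upper2)
  show "(0::real) \<in> {0..<1}" by simp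
  show "bdd_above (square_mean f ` {0..<1})" using assms by (simp add: H2_eq)
qed (rule square_mean_nonneg)

lemma H2_norm_nonneg: "f \<in> H2 \<Longrightarrow> 0 \<le> H2_norm f"
  unfolding H2_norm_def square_mean_def[symmetric] by (simp add: SUP_square_mean_nonneg)

lemma H2_norm_power2:
  assumes "f \<in> H2"
  shows "(H2_norm f)\<^sup>2 = (SUP r\<in>{0..<1}. square_mean f r)"
  unfolding H2_norm_def square_mean_def[symmetric] by (simp add: SUP_square_mean_nonneg assms)

lemma square_mean_le_H2_norm:
  assumes "f \<in> H2" "0 \<le> r" "r < 1"
  shows "square_mean f r \<le> (H2_norm f)\<^sup>2"
  using assms by (auto simp: H2_norm_power2 H2_eq intro!: cSUP_upper)

lemma eventually_at_left_1: "eventually (\<lambda>r::real. 0 \<le> r \<and> r < 1) (at_left 1)"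
  using eventually_at_left_real[of 0 "1::real"] by (auto elim: eventually_mono)

lemma square_mean_tendsto:
  assumes f: "f \<in> H2"
  shows "(square_mean f \<longlongrightarrow> (H2_norm f)\<^sup>2) (at_left 1)"
proof (rule order_tendstoI)
  fix a assume "a < (H2_norm f)\<^sup>2"
  then obtain s where s: "0 \<le> s" "s < 1" "a < square_mean f s"
    using f by (auto simp: H2_norm_power2 H2_eq less_cSUP_iff)
  have "eventually (\<lambda>r. r \<in> {s<..<1}) (at_left (1::real))"
    by (rule eventually_at_left_real[OF s(2)])
  then show "eventually (\<lambda>r. a < square_mean f r) (at_left 1)"
  proof eventually_elim
    case (elim r)
    then show ?case
      using torus_mean_mono[OF H2_analytic[OF f], of s r] s by (simp add: square_mean_def)
  qed
next
  fix a assume a: "(H2_norm f)\<^sup>2 < a"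
  show "eventually (\<lambda>r. square_mean f r < a) (at_left 1)"
    using eventually_at_left_1
  proof eventually_elim
    case (elim r)
    then show ?case using square_mean_le_H2_norm[OF f, of r] a by simp
  qed
qed

lemma H2_norm_power2_le:
  assumes "f \<in> H2" "\<And>r. 0 \<le> r \<Longrightarrow> r < 1 \<Longrightarrow> square_mean f r \<le> B"
  shows "(H2_norm f)\<^sup>2 \<le> B"
  unfolding H2_norm_power2[OF assms(1)] by (rule cSUP_least) (use assms(2) in auto)

lemma analytic_zero: "(\<lambda>z. 0) \<in> analytic_functions"
  by (auto simp: analytic_functions_def analytic_several_on_def intro!: exI[of _ "\<lambda>_. 0"])

lemma analytic_add:
  assumes "f \<in> analytic_functions" "g \<in> analytic_functions"
  shows "(\<lambda>z. f z + g z) \<in> analytic_functions"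
  unfolding analytic_functions_def analytic_several_on_def
proof safe
  fix z :: "complex ^ 'a" assume "z \<in> polydisc"
  then obtain D E where "(f has_derivative D) (at z)" "\<forall>c v. D (c *s v) = c * D v"
    "(g has_derivative E) (at z)" "\<forall>c v. E (c *s v) = c * E v"
    using assms unfolding analytic_functions_def analytic_several_on_def by blast
  then show "\<exists>D. ((\<lambda>z. f z + g z) has_derivative D) (at z) \<and> (\<forall>c v. D (c *s v) = c * D v)"
    by (intro exI[of _ "\<lambda>h. D h + E h"]) (auto intro: has_derivative_add simp: algebra_simps)
qed (use assms in \<open>auto simp: analytic_functions_def\<close>)

lemma analytic_mult:
  assumes f: "analytic_several_on f polydisc" and g: "g \<in> analytic_functions"
  shows "(\<lambda>z. f z * g z) \<in> analytic_functions"
  unfolding analytic_functions_def analytic_several_on_def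
proof safe
  fix z :: "complex ^ 'a" assume "z \<in> polydisc"
  then obtain D E where "(f has_derivative D) (at z)" "\<forall>c v. D (c *s v) = c * D v"
    "(g has_derivative E) (at z)" "\<forall>c v. E (c *s v) = c * E v"
    using assms unfolding analytic_functions_def analytic_several_on_def by blast
  then show "\<exists>D. ((\<lambda>z. f z * g z) has_derivative D) (at z) \<and> (\<forall>c v. D (c *s v) = c * D v)"
    by (intro exI[of _ "\<lambda>h. f z * E h + D h * g z"] conjI has_derivative_mult)
       (auto simp: algebra_simps)
qed (use assms in \<open>auto simp: analytic_functions_def\<close>)

lemma analytic_several_const: "analytic_several_on (\<lambda>_. c) S"
  by (auto simp: analytic_several_on_def intro!: exI[of _ "\<lambda>_. 0"])

lemma analytic_cmult: "f \<in> analytic_functions \<Longrightarrow> (\<lambda>z. c * f z) \<in> analytic_functions"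
  by (rule analytic_mult[OF analytic_several_const])

lemma analytic_diff:
  assumes "f \<in> analytic_functions" "g \<in> analytic_functions"
  shows "(\<lambda>z. f z - g z) \<in> analytic_functions"
  using analytic_add[OF assms(1) analytic_cmult[OF assms(2), of "-1"]] by simp

lemma square_mean_cmult: "square_mean (\<lambda>z. c * f z) r = (norm c)\<^sup>2 * square_mean f r"
  by (simp add: square_mean_def norm_mult power_mult_distrib)

lemma square_mean_add_le:
  assumes f: "f \<in> analytic_functions" and g: "g \<in> analytic_functions" and r: "0 \<le> r" "r < 1"
  shows "square_mean (\<lambda>z. f z + g z) r \<le> 2 * square_mean f r + 2 * square_mean g r"
proof -
  have "square_mean (\<lambda>z. f z + g z) r
      \<le> (\<integral>z. 2 * (norm (f (r *\<^sub>R z)))\<^sup>2 + 2 * (norm (g (r *\<^sub>R z)))\<^sup>2 \<partial>torus_measure)"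
    unfolding square_mean_def
  proof (rule integral_mono)
    fix z
    have "(norm (f (r *\<^sub>R z) + g (r *\<^sub>R z)))\<^sup>2 \<le> (norm (f (r *\<^sub>R z)) + norm (g (r *\<^sub>R z)))\<^sup>2"
      by (intro power_mono norm_triangle_ineq) simp
    also have "\<dots> \<le> 2 * (norm (f (r *\<^sub>R z)))\<^sup>2 + 2 * (norm (g (r *\<^sub>R z)))\<^sup>2"
      using zero_le_power2[of "norm (f (r *\<^sub>R z)) - norm (g (r *\<^sub>R z))"]
      by (simp add: power2_eq_square algebra_simps)
    finally show "(norm (f (r *\<^sub>R z) + g (r *\<^sub>R z)))\<^sup>2 \<le> 2 * (norm (f (r *\<^sub>R z)))\<^sup>2 + 2 * (norm (g (r *\<^sub>R z)))\<^sup>2" .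
  qed (use r in \<open>auto intro!: integrable_torus_square analytic_add f g\<close>)
  also have "\<dots> = 2 * square_mean f r + 2 * square_mean g r"
    unfolding square_mean_def using r
    by (subst Bochner_Integration.integral_add) (auto intro!: integrable_torus_square f g)
  finally show ?thesis .
qed

lemma H2_zero: "(\<lambda>z. 0) \<in> H2"
  by (rule H2_I[where B=0]) (auto simp: analytic_zero square_mean_def)

lemma H2_add:
  assumes f: "f \<in> H2" and g: "g \<in> H2"
  shows "(\<lambda>z. f z + g z) \<in> H2"
proof (rule H2_I)
  show "(\<lambda>z. f z + g z) \<in> analytic_functions"
    using assms by (intro analytic_add H2_analytic)
  show "square_mean (\<lambda>z. f z + g z) r \<le> 2 * (H2_norm f)\<^sup>2 + 2 * (H2_norm g)\<^sup>2" if "0 \<le> r" "r < 1" for r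
    using square_mean_add_le[OF H2_analytic[OF f] H2_analytic[OF g] that]
      square_mean_le_H2_norm[OF f that] square_mean_le_H2_norm[OF g that] by linarith
qed

lemma H2_cmult:
  assumes f: "f \<in> H2"
  shows "(\<lambda>z. c * f z) \<in> H2"
proof (rule H2_I)
  show "(\<lambda>z. c * f z) \<in> analytic_functions"
    using assms by (intro analytic_cmult H2_analytic)
  show "square_mean (\<lambda>z. c * f z) r \<le> (norm c)\<^sup>2 * (H2_norm f)\<^sup>2" if "0 \<le> r" "r < 1" for r
    unfolding square_mean_cmult by (intro mult_left_mono square_mean_le_H2_norm f that) simp
qed

lemma H2_diff: "f \<in> H2 \<Longrightarrow> g \<in> H2 \<Longrightarrow> (\<lambda>z. f z - g z) \<in> H2"
  using H2_add[of f "\<lambda>z. -1 * g z"] H2_cmult[of g "-1"] by simp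

text \<open>Polarization reduces the existence of the limit in \<open>H2_inner\<close> to that of the limits of means.\<close>

lemma integral_torus_product_polarization:
  assumes f: "f \<in> analytic_functions" and g: "g \<in> analytic_functions" and r: "0 \<le> r" "r < 1"
  shows "(\<integral>z. f (r *\<^sub>R z) * cnj (g (r *\<^sub>R z)) \<partial>torus_measure)
    = (\<Sum>k<4. \<i> ^ k * of_real (square_mean (\<lambda>z. f z + \<i> ^ k * g z) r)) / 4"
proof -
  have pol: "a * cnj b = (\<Sum>k<4. \<i> ^ k * ((a + \<i> ^ k * b) * cnj (a + \<i> ^ k * b))) / 4" for a b :: complex
    by (simp add: eval_nat_numeral algebra_simps)
  have an: "(\<lambda>z. f z + \<i> ^ k * g z) \<in> analytic_functions" for k
    by (intro analytic_add analytic_cmult f g)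
  have "(\<integral>z. f (r *\<^sub>R z) * cnj (g (r *\<^sub>R z)) \<partial>torus_measure)
    = (\<integral>z. (\<Sum>k<4. \<i> ^ k * ((f (r *\<^sub>R z) + \<i> ^ k * g (r *\<^sub>R z)) * cnj (f (r *\<^sub>R z) + \<i> ^ k * g (r *\<^sub>R z)))) / 4 \<partial>torus_measure)"
    by (subst pol) (rule refl)
  also have "\<dots> = (\<Sum>k<4. \<i> ^ k * (\<integral>z. (f (r *\<^sub>R z) + \<i> ^ k * g (r *\<^sub>R z)) * cnj (f (r *\<^sub>R z) + \<i> ^ k * g (r *\<^sub>R z)) \<partial>torus_measure)) / 4"
    using integrable_torus_product[OF an an r r]
    by (subst integral_divide_zero, subst Bochner_Integration.integral_sum) auto
  also have "\<dots> = (\<Sum>k<4. \<i> ^ k * of_real (square_mean (\<lambda>z. f z + \<i> ^ k * g z) r)) / 4"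
    using integral_torus_square[OF an r] by (simp add: square_mean_def)
  finally show ?thesis .
qed

lemma H2_inner_tendsto:
  assumes f: "f \<in> H2" and g: "g \<in> H2"
  shows "((\<lambda>r. \<integral>z. f (r *\<^sub>R z) * cnj (g (r *\<^sub>R z)) \<partial>torus_measure) \<longlongrightarrow> H2_inner f g) (at_left 1)"
proof -
  have H: "(\<lambda>z. f z + \<i> ^ k * g z) \<in> H2" for k
    by (intro H2_add H2_cmult f g)
  have "((\<lambda>r. (\<Sum>k<4. \<i> ^ k * of_real (square_mean (\<lambda>z. f z + \<i> ^ k * g z) r)) / 4)
     \<longlongrightarrow> (\<Sum>k<4. \<i> ^ k * of_real ((H2_norm (\<lambda>z. f z + \<i> ^ k * g z))\<^sup>2)) / 4) (at_left 1)"
    by (intro tendsto_intros square_mean_tendsto H) simp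
  moreover have "eventually (\<lambda>r. (\<Sum>k<4. \<i> ^ k * of_real (square_mean (\<lambda>z. f z + \<i> ^ k * g z) r)) / 4
     = (\<integral>z. f (r *\<^sub>R z) * cnj (g (r *\<^sub>R z)) \<partial>torus_measure)) (at_left 1)"
    using eventually_at_left_1
    by eventually_elim (use f g in \<open>simp add: integral_torus_product_polarization H2_analytic\<close>)
  ultimately have "((\<lambda>r. \<integral>z. f (r *\<^sub>R z) * cnj (g (r *\<^sub>R z)) \<partial>torus_measure)
     \<longlongrightarrow> (\<Sum>k<4. \<i> ^ k * of_real ((H2_norm (\<lambda>z. f z + \<i> ^ k * g z))\<^sup>2)) / 4) (at_left 1)"
    by (rule Lim_transform_eventually)
  moreover from this have "H2_inner f g = (\<Sum>k<4. \<i> ^ k * of_real ((H2_norm (\<lambda>z. f z + \<i> ^ k * g z))\<^sup>2)) / 4"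
    unfolding H2_inner_def by (intro tendsto_Lim) auto
  ultimately show ?thesis by (simp only:)
qed

text \<open>The identities of the inner product are read off from those of the integrals before the limit.\<close>

lemma H2_inner_eqI:
  assumes "f \<in> H2" "g \<in> H2" "(F \<longlongrightarrow> l) (at_left 1)"
    and "\<And>r. 0 \<le> r \<Longrightarrow> r < 1 \<Longrightarrow> (\<integral>z. f (r *\<^sub>R z) * cnj (g (r *\<^sub>R z)) \<partial>torus_measure) = F r"
  shows "H2_inner f g = l"
proof (rule tendsto_unique)
  show "((\<lambda>r. \<integral>z. f (r *\<^sub>R z) * cnj (g (r *\<^sub>R z)) \<partial>torus_measure) \<longlongrightarrow> H2_inner f g) (at_left 1)"
    by (rule H2_inner_tendsto) fact+
  have "eventually (\<lambda>r. F r = (\<integral>z. f (r *\<^sub>R z) * cnj (g (r *\<^sub>R z)) \<partial>torus_measure)) (at_left 1)"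
    using eventually_at_left_1 by eventually_elim (use assms(4) in simp)
  with assms(3) show "((\<lambda>r. \<integral>z. f (r *\<^sub>R z) * cnj (g (r *\<^sub>R z)) \<partial>torus_measure) \<longlongrightarrow> l) (at_left 1)"
    by (rule Lim_transform_eventually)
qed simp

lemma H2_inner_self:
  assumes "f \<in> H2" shows "H2_inner f f = of_real ((H2_norm f)\<^sup>2)"
  by (rule H2_inner_eqI[OF assms assms tendsto_of_real[OF square_mean_tendsto[OF assms]]])
     (simp add: integral_torus_square H2_analytic assms square_mean_def)

lemma H2_inner_commute:
  assumes "f \<in> H2" "g \<in> H2"
  shows "H2_inner f g = cnj (H2_inner g f)"
  by (rule H2_inner_eqI[OF assms tendsto_cnj[OF H2_inner_tendsto[OF assms(2,1)]]])
     (subst Bochner_Integration.integral_cnj[symmetric], simp add: mult.commute)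

lemma H2_inner_add_left:
  assumes "f \<in> H2" "g \<in> H2" "h \<in> H2"
  shows "H2_inner (\<lambda>z. f z + g z) h = H2_inner f h + H2_inner g h"
  by (rule H2_inner_eqI[OF H2_add _ tendsto_add[OF H2_inner_tendsto H2_inner_tendsto]])
     (auto simp: assms distrib_right integrable_torus_product H2_analytic)

lemma H2_inner_cmult_left:
  assumes "f \<in> H2" "g \<in> H2"
  shows "H2_inner (\<lambda>z. c * f z) g = c * H2_inner f g"
  by (rule H2_inner_eqI[OF H2_cmult _ tendsto_mult_left[OF H2_inner_tendsto]])
     (auto simp: assms mult.assoc)

lemma H2_point_bound:
  fixes f :: "complex ^ 'n::finite \<Rightarrow> complex" and w :: "complex ^ 'n"
  assumes f: "f \<in> H2" and w: "\<And>i. norm (w $ i) \<le> \<rho>" and \<rho>: "\<rho> < 1"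
  shows "(norm (f w))\<^sup>2 \<le> ((1 + \<rho>) / (1 - \<rho>)) ^ CARD('n) * (H2_norm f)\<^sup>2"
proof -
  have \<rho>0: "0 \<le> \<rho>" using w[of undefined] norm_ge_zero order_trans by blast
  \<comment> \<open>Any radius strictly between \<open>\<rho>\<close> and 1 serves.\<close>
  define r where "r = (1 + \<rho>) / 2"
  have r: "\<rho> < r" "r < 1" "0 \<le> r" using \<rho> \<rho>0 by (auto simp: r_def)
  have eq: "r / (r - \<rho>) = (1 + \<rho>) / (1 - \<rho>)" using \<rho> by (simp add: r_def field_simps)
  have "(norm (f w))\<^sup>2 \<le> (r / (r - \<rho>)) ^ CARD('n) * square_mean f r"
    using analytic_point_bound[OF H2_analytic[OF f] w r(1,2)] by (simp add: square_mean_def)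
  also have "\<dots> \<le> (r / (r - \<rho>)) ^ CARD('n) * (H2_norm f)\<^sup>2"
    using r by (intro mult_left_mono square_mean_le_H2_norm f) auto
  finally show ?thesis by (simp add: eq)
qed

lemma polydisc_radius:
  fixes w :: "complex ^ 'n::finite"
  assumes "w \<in> polydisc"
  obtains \<rho> where "0 \<le> \<rho>" "\<rho> < 1" "\<And>i. norm (w $ i) \<le> \<rho>"
proof
  define \<rho> where "\<rho> = Max (range (\<lambda>i. norm (w $ i)))"
  show le: "norm (w $ i) \<le> \<rho>" for i by (auto simp: \<rho>_def intro!: Max_ge)
  have "\<rho> \<in> range (\<lambda>i. norm (w $ i))" unfolding \<rho>_def by (rule Max_in) auto
  then show "\<rho> < 1" using assms by (auto simp: polydisc_def)
  show "0 \<le> \<rho>" using le[of undefined] norm_ge_zero order_trans by blast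
qed

lemma H2_norm_eq_0_iff:
  assumes f: "f \<in> H2"
  shows "H2_norm f = 0 \<longleftrightarrow> f = (\<lambda>z. 0)"
proof
  assume 0: "H2_norm f = 0"
  show "f = (\<lambda>z. 0)"
  proof
    fix z
    show "f z = 0"
    proof (cases "z \<in> polydisc")
      case True
      then obtain \<rho> where "0 \<le> \<rho>" "\<rho> < 1" "\<And>i. norm (z $ i) \<le> \<rho>"
        by (rule polydisc_radius) (rule that)
      then show ?thesis using H2_point_bound[OF f, of z \<rho>] 0 by simp
    qed (use f in \<open>auto simp: H2_def\<close>)
  qed
next
  assume "f = (\<lambda>z. 0)"
  then show "H2_norm f = 0"
    using H2_norm_power2[OF f] by (simp add: square_mean_def)
qed

section \<open>The Hardy space as a Hilbert space\<close>

text \<open>A type of its own gives access to the normed-space theory of the class \<open>real_inner\<close>. Its inner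
  product is the real part of \<open>H2_inner\<close>, which induces the same norm.\<close>

typedef ('n::finite) hardy = "H2 :: (complex ^ 'n \<Rightarrow> complex) set"
  morphisms fun_of Hardy
  using H2_zero by blast

lemmas fun_of_H2 [simp] = fun_of

lemma fun_of_Hardy [simp]: "f \<in> H2 \<Longrightarrow> fun_of (Hardy f) = f"
  by (rule Hardy_inverse)

instantiation hardy :: (finite) real_vector
begin

definition zero_hardy :: "'a hardy" where "0 = Hardy (\<lambda>z. 0)"
definition plus_hardy :: "'a hardy \<Rightarrow> 'a hardy \<Rightarrow> 'a hardy"
  where "x + y = Hardy (\<lambda>z. fun_of x z + fun_of y z)"
definition minus_hardy :: "'a hardy \<Rightarrow> 'a hardy \<Rightarrow> 'a hardy"
  where "x - y = Hardy (\<lambda>z. fun_of x z - fun_of y z)"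
definition uminus_hardy :: "'a hardy \<Rightarrow> 'a hardy" where "- x = Hardy (\<lambda>z. - fun_of x z)"
definition scaleR_hardy :: "real \<Rightarrow> 'a hardy \<Rightarrow> 'a hardy"
  where "r *\<^sub>R x = Hardy (\<lambda>z. of_real r * fun_of x z)"

lemma fun_of_zero [simp]: "fun_of 0 = (\<lambda>z. 0)"
  by (simp add: zero_hardy_def H2_zero)

lemma fun_of_add [simp]: "fun_of (x + y) = (\<lambda>z. fun_of x z + fun_of y z)"
  by (simp add: plus_hardy_def H2_add)

lemma fun_of_diff [simp]: "fun_of (x - y) = (\<lambda>z. fun_of x z - fun_of y z)"
  by (simp add: minus_hardy_def H2_diff)

lemma fun_of_uminus [simp]: "fun_of (- x) = (\<lambda>z. - fun_of x z)"
  using H2_cmult[of "fun_of x" "-1"] by (simp add: uminus_hardy_def)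

lemma fun_of_scaleR [simp]: "fun_of (r *\<^sub>R x) = (\<lambda>z. of_real r * fun_of x z)"
  by (simp add: scaleR_hardy_def H2_cmult)

instance
  by standard (simp_all add: fun_of_inject[symmetric] algebra_simps fun_eq_iff)

end

instantiation hardy :: (finite) real_inner
begin

definition norm_hardy :: "'a hardy \<Rightarrow> real" where "norm x = H2_norm (fun_of x)"
definition inner_hardy :: "'a hardy \<Rightarrow> 'a hardy \<Rightarrow> real"
  where "x \<bullet> y = Re (H2_inner (fun_of x) (fun_of y))"
definition "sgn x = x /\<^sub>R norm x" for x :: "'a hardy"
definition "dist x y = norm (x - y)" for x y :: "'a hardy"
definition "(uniformity :: ('a hardy \<times> 'a hardy) filter) = (INF e\<in>{0 <..}. principal {(x, y). dist x y < e})"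
definition "open U \<longleftrightarrow> (\<forall>x\<in>U. \<forall>\<^sub>F (x', y) in uniformity. x' = x \<longrightarrow> y \<in> U)" for U :: "'a hardy set"

instance
proof
  fix x y z :: "'a hardy" and r s :: real
  show "x \<bullet> y = y \<bullet> x"
    unfolding inner_hardy_def by (subst H2_inner_commute) simp_all
  show "(x + y) \<bullet> z = x \<bullet> z + y \<bullet> z"
    by (simp add: inner_hardy_def H2_inner_add_left)
  show "(r *\<^sub>R x) \<bullet> y = r * (x \<bullet> y)"
    by (simp add: inner_hardy_def H2_inner_cmult_left)
  show "0 \<le> x \<bullet> x"
    by (simp add: inner_hardy_def H2_inner_self)
  show "x \<bullet> x = 0 \<longleftrightarrow> x = 0"
    by (simp add: inner_hardy_def H2_inner_self H2_norm_eq_0_iff fun_of_inject[symmetric])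
  show "norm x = sqrt (x \<bullet> x)"
    by (simp add: inner_hardy_def H2_inner_self norm_hardy_def H2_norm_nonneg)
qed (simp_all only: dist_hardy_def sgn_hardy_def uniformity_hardy_def open_hardy_def)

end

lemma analytic_fun_of [simp]: "fun_of x \<in> analytic_functions"
  by (simp add: H2_analytic)

lemma square_mean_le_norm:
  "0 \<le> r \<Longrightarrow> r < 1 \<Longrightarrow> square_mean (fun_of x) r \<le> (norm x)\<^sup>2"
  by (simp add: norm_hardy_def square_mean_le_H2_norm)

lemma norm_power2_le:
  "(\<And>r. 0 \<le> r \<Longrightarrow> r < 1 \<Longrightarrow> square_mean (fun_of x) r \<le> B) \<Longrightarrow> (norm x)\<^sup>2 \<le> B"
  by (simp add: norm_hardy_def H2_norm_power2_le)

lemma norm_fun_of_le: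
  fixes x :: "'n::finite hardy" and w :: "complex ^ 'n"
  assumes "\<And>i. norm (w $ i) \<le> \<rho>" "0 \<le> \<rho>" "\<rho> < 1"
  shows "norm (fun_of x w) \<le> sqrt (((1 + \<rho>) / (1 - \<rho>)) ^ CARD('n)) * norm x"
proof -
  have "(norm (fun_of x w))\<^sup>2 \<le> ((1 + \<rho>) / (1 - \<rho>)) ^ CARD('n) * (norm x)\<^sup>2"
    unfolding norm_hardy_def by (rule H2_point_bound[OF _ assms(1,3)]) simp
  then have "norm (fun_of x w) \<le> sqrt (((1 + \<rho>) / (1 - \<rho>)) ^ CARD('n) * (norm x)\<^sup>2)"
    by (rule real_le_rsqrt)
  then show ?thesis using assms by (simp add: real_sqrt_mult)
qed

lemma norm_scale_vec: "norm (c *s v) = norm c * norm (v :: complex ^ 'n::finite)"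
  by (simp add: norm_vec_def norm_mult L2_set_right_distrib)

text \<open>Cauchy's inequality for the restriction of \<open>f\<close> to the complex line through \<open>x\<close> in the direction of \<open>h\<close>.\<close>

lemma analytic_derivative_bound:
  fixes f :: "complex ^ 'n::finite \<Rightarrow> complex"
  assumes f: "f \<in> analytic_functions" and D: "(f has_derivative D) (at x)" "\<And>c v. D (c *s v) = c * D v"
    and \<delta>: "0 < \<delta>" "cball x \<delta> \<subseteq> polydisc" and B: "\<And>y. y \<in> cball x \<delta> \<Longrightarrow> norm (f y) \<le> B"
  shows "norm (D h) \<le> B / \<delta> * norm h"
proof (cases "h = 0")
  case True
  then show ?thesis using D(2)[of 0 0] by simp
next
  case False
  define u where "u = (1 / of_real (norm h) :: complex) *s h"
  have u: "norm u = 1" "h = of_real (norm h) *s u"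
    using False by (simp_all add: u_def norm_scale_vec norm_divide)
  define g where "g w = f (x + w *s u)" for w
  have cont: "continuous_on UNIV (\<lambda>w. x + w *s u)"
    unfolding vector_scalar_mult_def by (intro continuous_intros)
  define S where "S = (\<lambda>w. x + w *s u) -` polydisc"
  have S: "open S" unfolding S_def by (rule open_vimage[OF open_polydisc cont])
  have sub: "cball 0 \<delta> \<subseteq> S"
    using \<delta>(2) u by (auto simp: S_def subset_iff dist_norm norm_scale_vec)
  have hol: "g holomorphic_on S"
    unfolding g_def by (rule analytic_on_complex_line[OF f S]) (simp add: S_def)
  have "(g has_field_derivative (D u)) (at 0)"
    unfolding g_def by (rule has_field_derivative_along_line) (use D in simp_all)
  then have "deriv g 0 = D u" by (rule DERIV_imp_deriv)
  moreover have "norm ((deriv ^^ 1) g 0) \<le> fact 1 * B / \<delta> ^ 1"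
  proof (rule Cauchy_inequality)
    show "g holomorphic_on ball 0 \<delta>" by (rule holomorphic_on_subset[OF hol order_trans[OF ball_subset_cball sub]])
    show "continuous_on (cball 0 \<delta>) g"
      using sub by (intro holomorphic_on_imp_continuous_on holomorphic_on_subset[OF hol])
    show "norm (g w) \<le> B" if "norm (0 - w) = \<delta>" for w
      unfolding g_def by (rule B) (use that u in \<open>simp add: dist_norm norm_scale_vec\<close>)
  qed (rule \<delta>(1))
  ultimately have Du: "norm (D u) \<le> B / \<delta>" by simp
  have "D h = of_real (norm h) * D u" using D(2)[of "of_real (norm h)" u] u(2) by simp
  then show ?thesis
    using mult_right_mono[OF Du norm_ge_zero[of h]] by (simp add: norm_mult mult.commute)
qed

lemma norm_nth_less_radius:
  fixes x y :: "complex ^ 'n::finite"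
  assumes "norm (x $ i) \<le> \<rho>" "dist x y \<le> \<delta>"
  shows "norm (y $ i) \<le> \<rho> + \<delta>"
proof -
  have "norm (y $ i) \<le> norm (x $ i) + norm ((y - x) $ i)"
    using norm_triangle_ineq[of "x $ i" "(y - x) $ i"] by simp
  also have "norm ((y - x) $ i) \<le> dist x y"
    using Finite_Cartesian_Product.norm_nth_le[of "y - x" i] by (simp only: dist_norm norm_minus_commute[of x y])
  finally show ?thesis using assms by linarith
qed

text \<open>Cauchy's estimate turns uniform convergence into uniform convergence of the derivatives
  on smaller balls, so that limit and derivative can be interchanged.\<close>

lemma analytic_limit:
  fixes f :: "nat \<Rightarrow> complex ^ 'n::finite \<Rightarrow> complex"
  assumes f: "\<And>n. f n \<in> analytic_functions"
    and unif: "\<And>\<rho>. 0 \<le> \<rho> \<Longrightarrow> \<rho> < 1 \<Longrightarrow> uniformly_Cauchy_on {z. \<forall>i. norm (z $ i) \<le> \<rho>} f"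
  obtains F where "F \<in> analytic_functions" "\<And>z. (\<lambda>n. f n z) \<longlonglongrightarrow> F z"
proof -
  define F where "F z = lim (\<lambda>n. f n z)" for z
  have F: "(\<lambda>n. f n z) \<longlonglongrightarrow> F z" for z
  proof (cases "z \<in> polydisc")
    case True
    then obtain \<rho> where \<rho>: "0 \<le> \<rho>" "\<rho> < 1" "\<And>i. norm (z $ i) \<le> \<rho>"
      by (rule polydisc_radius) (rule that)
    have "Cauchy (\<lambda>n. f n z)"
      unfolding Cauchy_def
    proof (intro allI impI)
      fix e :: real assume "e > 0"
      then show "\<exists>M. \<forall>m\<ge>M. \<forall>n\<ge>M. dist (f m z) (f n z) < e"
        using unif[OF \<rho>(1,2)] \<rho>(3) unfolding uniformly_Cauchy_on_def by blast
    qed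
    then show ?thesis
      unfolding F_def by (simp add: Cauchy_convergent_iff convergent_LIMSEQ_iff)
  next
    case False
    then have "f n z = 0" for n using f[of n] by (simp add: analytic_functions_def)
    then show ?thesis by (simp add: F_def)
  qed
  have "\<exists>D. (F has_derivative D) (at x0) \<and> (\<forall>c v. D (c *s v) = c * D v)" if "x0 \<in> polydisc" for x0
  proof -
    obtain \<rho>0 where \<rho>0: "0 \<le> \<rho>0" "\<rho>0 < 1" "\<And>i. norm (x0 $ i) \<le> \<rho>0"
      using \<open>x0 \<in> polydisc\<close> by (rule polydisc_radius) (rule that)
    \<comment> \<open>All balls of radius \<open>\<delta>\<close> about points of the ball of radius \<open>\<delta>\<close> about \<open>x0\<close> lie in the
      polydisc of radius \<open>\<rho>\<close>.\<close>
    define \<delta> where "\<delta> = (1 - \<rho>0) / 4"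
    define \<rho> where "\<rho> = \<rho>0 + \<delta> + \<delta>"
    have \<delta>: "0 < \<delta>" and \<rho>: "0 \<le> \<rho>" "\<rho> < 1" using \<rho>0 by (simp_all add: \<delta>_def \<rho>_def field_simps)
    have K: "norm (y $ i) \<le> \<rho>" if "x \<in> ball x0 \<delta>" "y \<in> cball x \<delta>" for x y :: "complex ^ 'n" and i
      unfolding \<rho>_def
      by (intro norm_nth_less_radius[of x _ _ y] norm_nth_less_radius[of x0 _ _ x] \<rho>0)
         (use that in auto)
    have inpoly: "cball x \<delta> \<subseteq> polydisc" if "x \<in> ball x0 \<delta>" for x
      unfolding polydisc_def using order.strict_trans1[OF K[OF that] \<rho>(2)] by blast
    have "\<forall>n x. \<exists>D. x \<in> ball x0 \<delta> \<longrightarrow> (f n has_derivative D) (at x) \<and> (\<forall>c v. D (c *s v) = c * D v)"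
      using f inpoly \<delta> unfolding analytic_functions_def analytic_several_on_def
      by (smt (verit) centre_in_cball mem_Collect_eq subsetD)
    then obtain D where "\<forall>n x. x \<in> ball x0 \<delta> \<longrightarrow>
        (f n has_derivative D n x) (at x) \<and> (\<forall>c v. D n x (c *s v) = c * D n x v)"
      by metis
    then have D: "(f n has_derivative D n x) (at x)" "\<And>c v. D n x (c *s v) = c * D n x v"
      if "x \<in> ball x0 \<delta>" for n x
      using that by auto
    have est: "\<exists>N. \<forall>m\<ge>N. \<forall>n\<ge>N. \<forall>x\<in>ball x0 \<delta>. \<forall>h. norm (D m x h - D n x h) \<le> e * norm h" if e: "e > 0" for e
    proof -
      have "e * \<delta> > 0" using e \<delta> by simp
      then obtain N where N: "\<And>m n z. m \<ge> N \<Longrightarrow> n \<ge> N \<Longrightarrow> (\<And>i. norm (z $ i) \<le> \<rho>) \<Longrightarrow> dist (f m z) (f n z) < e * \<delta>"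
        using unif[OF \<rho>] unfolding uniformly_Cauchy_on_def by blast
      show ?thesis
      proof (intro exI allI impI ballI)
        fix m n x h assume mn: "m \<ge> N" "n \<ge> N" and x: "x \<in> ball x0 \<delta>"
        have "norm (D m x h - D n x h) \<le> e * \<delta> / \<delta> * norm h"
        proof (rule analytic_derivative_bound)
          show "(\<lambda>z. f m z - f n z) \<in> analytic_functions" by (intro analytic_diff f)
          show "((\<lambda>z. f m z - f n z) has_derivative (\<lambda>h. D m x h - D n x h)) (at x)"
            by (intro has_derivative_diff D x)
          show "D m x (c *s v) - D n x (c *s v) = c * (D m x v - D n x v)" for c v
            by (simp add: D(2)[OF x] algebra_simps)
          show "norm (f m y - f n y) \<le> e * \<delta>" if "y \<in> cball x \<delta>" for y
            using N[OF mn, of y] K[OF x that] by (simp add: dist_norm less_imp_le)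
        qed (use \<delta> inpoly[OF x] in auto)
        then show "norm (D m x h - D n x h) \<le> e * norm h" using \<delta> by simp
      qed
    qed
    define D' where "D' x h = lim (\<lambda>n. D n x h)" for x h
    have D': "(\<lambda>n. D n x h) \<longlonglongrightarrow> D' x h" if x: "x \<in> ball x0 \<delta>" for x h
    proof -
      have "Cauchy (\<lambda>n. D n x h)"
        unfolding Cauchy_def
      proof (intro allI impI)
        fix e :: real assume e: "e > 0"
        have n0: "0 < norm h + 1" by (simp add: add_nonneg_pos)
        obtain N where N: "\<forall>m\<ge>N. \<forall>n\<ge>N. \<forall>x\<in>ball x0 \<delta>. \<forall>v. norm (D m x v - D n x v) \<le> e / (norm h + 1) * norm v"
          using est[OF divide_pos_pos[OF e n0]] ..
        have "e / (norm h + 1) * norm h < e"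
          using e n0 by (simp add: divide_less_eq distrib_left)
        then have "dist (D m x h) (D n x h) < e" if "m \<ge> N" "n \<ge> N" for m n
          unfolding dist_norm using N that x by (intro le_less_trans[OF _ \<open>e / (norm h + 1) * norm h < e\<close>]) simp
        then show "\<exists>M. \<forall>m\<ge>M. \<forall>n\<ge>M. dist (D m x h) (D n x h) < e" by blast
      qed
      then show ?thesis
        unfolding D'_def by (simp add: Cauchy_convergent_iff convergent_LIMSEQ_iff)
    qed
    have "\<exists>g. \<forall>x\<in>ball x0 \<delta>. (\<lambda>n. f n x) \<longlonglongrightarrow> g x \<and> (g has_derivative D' x) (at x within ball x0 \<delta>)"
    proof (rule has_derivative_sequence)
      show "(f n has_derivative D n x) (at x within ball x0 \<delta>)" if "x \<in> ball x0 \<delta>" for n x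
        using D(1)[OF that] by (rule has_derivative_at_withinI)
      show "\<forall>\<^sub>F n in sequentially. \<forall>x\<in>ball x0 \<delta>. \<forall>h. norm (D n x h - D' x h) \<le> e * norm h" if e: "e > 0" for e
      proof -
        obtain N where N: "\<forall>m\<ge>N. \<forall>n\<ge>N. \<forall>x\<in>ball x0 \<delta>. \<forall>h. norm (D m x h - D n x h) \<le> e * norm h"
          using est[OF e] ..
        have "norm (D n x h - D' x h) \<le> e * norm h" if "n \<ge> N" "x \<in> ball x0 \<delta>" for n x h
        proof (rule LIMSEQ_le_const2)
          show "(\<lambda>m. norm (D n x h - D m x h)) \<longlonglongrightarrow> norm (D n x h - D' x h)"
            by (intro tendsto_intros D' that)
          show "\<exists>M. \<forall>m\<ge>M. norm (D n x h - D m x h) \<le> e * norm h"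
            using N that by blast
        qed
        then show ?thesis unfolding eventually_sequentially by (intro exI[of _ N]) simp
      qed
      show "x0 \<in> ball x0 \<delta>" using \<delta> by simp
      show "(\<lambda>n. f n x0) \<longlonglongrightarrow> F x0" by (rule F)
    qed simp
    then obtain g where g: "\<And>x. x \<in> ball x0 \<delta> \<Longrightarrow> (\<lambda>n. f n x) \<longlonglongrightarrow> g x"
      "\<And>x. x \<in> ball x0 \<delta> \<Longrightarrow> (g has_derivative D' x) (at x within ball x0 \<delta>)" by blast
    have x0: "x0 \<in> ball x0 \<delta>" using \<delta> by simp
    have eq: "g x = F x" if "x \<in> ball x0 \<delta>" for x
      using LIMSEQ_unique[OF g(1)[OF that] F] .
    have "(g has_derivative D' x0) (at x0)"
      using g(2)[OF x0] x0 by (simp add: at_within_open[OF _ open_ball])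
    from has_derivative_transform_within_open[OF this open_ball x0 eq]
    have "(F has_derivative D' x0) (at x0)" .
    moreover have "D' x0 (c *s v) = c * D' x0 v" for c v
    proof (rule LIMSEQ_unique[OF D'[OF x0]])
      show "(\<lambda>n. D n x0 (c *s v)) \<longlonglongrightarrow> c * D' x0 v"
        unfolding D(2)[OF x0] by (intro tendsto_intros D' x0)
    qed
    ultimately show ?thesis by blast
  qed
  moreover have "F z = 0" if "z \<notin> polydisc" for z
    using F[of z] that f by (simp add: analytic_functions_def LIMSEQ_const_iff)
  ultimately have "F \<in> analytic_functions"
    by (simp add: analytic_functions_def analytic_several_on_def)
  then show ?thesis using F by (rule that)
qed

text \<open>By Fatou's lemma, pointwise convergence suffices.\<close>

lemma square_mean_limit_le:
  fixes f :: "nat \<Rightarrow> complex ^ 'n::finite \<Rightarrow> complex"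
  assumes f: "\<And>n. f n \<in> analytic_functions" and F: "F \<in> analytic_functions"
    and lim: "\<And>z. (\<lambda>n. f n z) \<longlonglongrightarrow> F z"
    and r: "0 \<le> r" "r < 1" and B: "\<And>n. n \<ge> N \<Longrightarrow> square_mean (f n) r \<le> B"
  shows "square_mean F r \<le> B"
proof -
  have mean: "(\<integral>\<^sup>+z. ennreal ((norm (g (r *\<^sub>R z)))\<^sup>2) \<partial>torus_measure) = ennreal (square_mean g r)"
    if "g \<in> analytic_functions" for g :: "complex ^ 'n \<Rightarrow> complex"
    unfolding square_mean_def
    by (intro nn_integral_eq_integral integrable_torus_square that r) simp
  have [measurable]: "f n \<in> borel_measurable borel" for n using f[of n] by (rule analytic_borel_measurable)
  have "ennreal (square_mean F r) = (\<integral>\<^sup>+z. ennreal ((norm (F (r *\<^sub>R z)))\<^sup>2) \<partial>torus_measure)"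
    by (rule mean[OF F, symmetric])
  also have "\<dots> = (\<integral>\<^sup>+z. liminf (\<lambda>n. ennreal ((norm (f n (r *\<^sub>R z)))\<^sup>2)) \<partial>torus_measure)"
  proof (rule nn_integral_cong)
    fix z :: "complex ^ 'n"
    have "(\<lambda>n. ennreal ((norm (f n (r *\<^sub>R z)))\<^sup>2)) \<longlonglongrightarrow> ennreal ((norm (F (r *\<^sub>R z)))\<^sup>2)"
      by (intro tendsto_ennrealI tendsto_intros lim)
    from lim_imp_Liminf[OF trivial_limit_sequentially this]
    show "ennreal ((norm (F (r *\<^sub>R z)))\<^sup>2) = liminf (\<lambda>n. ennreal ((norm (f n (r *\<^sub>R z)))\<^sup>2))"
      by (rule sym)
  qed
  also have "\<dots> \<le> liminf (\<lambda>n. \<integral>\<^sup>+z. ennreal ((norm (f n (r *\<^sub>R z)))\<^sup>2) \<partial>torus_measure)"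
    by (rule nn_integral_liminf) measurable
  also have "\<dots> = liminf (\<lambda>n. ennreal (square_mean (f n) r))"
    by (simp add: mean f)
  also have "\<dots> \<le> ennreal B"
    by (rule Liminf_le)
       (auto simp: eventually_sequentially intro!: exI[of _ N] ennreal_leI B)
  finally show ?thesis
    using B[of N] square_mean_nonneg[of "f N" r] by (simp add: ennreal_le_iff)
qed

text \<open>By the point bound, a Cauchy sequence converges uniformly on smaller polydiscs to an analytic
  function. Bounds on the means pass to this limit, so it lies in the Hardy space and the convergence
  holds in norm.\<close>

instance hardy :: (finite) complete_space
proof
  fix X :: "nat \<Rightarrow> 'a hardy" assume X: "Cauchy X"
  have "uniformly_Cauchy_on {z. \<forall>i. norm (z $ i) \<le> \<rho>} (\<lambda>n. fun_of (X n))" if \<rho>: "0 \<le> \<rho>" "\<rho> < 1" for \<rho>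
    unfolding uniformly_Cauchy_on_def
  proof (intro allI impI)
    fix e :: real assume e: "e > 0"
    define C where "C = sqrt (((1 + \<rho>) / (1 - \<rho>)) ^ CARD('a))"
    have C: "C > 0" using \<rho> by (simp add: C_def)
    then obtain M where M: "\<And>m n. m \<ge> M \<Longrightarrow> n \<ge> M \<Longrightarrow> norm (X m - X n) < e / C"
      using X e unfolding Cauchy_def dist_norm by (meson divide_pos_pos)
    show "\<exists>M. \<forall>x\<in>{z. \<forall>i. norm (z $ i) \<le> \<rho>}. \<forall>m\<ge>M. \<forall>n\<ge>M. dist (fun_of (X m) x) (fun_of (X n) x) < e"
    proof (intro exI ballI allI impI)
      fix x :: "complex ^ 'a" and m n
      assume x: "x \<in> {z. \<forall>i. norm (z $ i) \<le> \<rho>}" and mn: "m \<ge> M" "n \<ge> M"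
      have "dist (fun_of (X m) x) (fun_of (X n) x) = norm (fun_of (X m - X n) x)"
        by (simp add: dist_norm)
      also have "\<dots> \<le> C * norm (X m - X n)"
        unfolding C_def by (rule norm_fun_of_le) (use x \<rho> in auto)
      also have "\<dots> < C * (e / C)" by (rule mult_strict_left_mono[OF M[OF mn] C])
      finally show "dist (fun_of (X m) x) (fun_of (X n) x) < e" using C by simp
    qed
  qed
  then obtain F where F: "F \<in> analytic_functions" "\<And>z. (\<lambda>n. fun_of (X n) z) \<longlonglongrightarrow> F z"
    using analytic_limit[of "\<lambda>n. fun_of (X n)"] by auto
  obtain B where B: "\<And>n. norm (X n) \<le> B"
    using Cauchy_Bseq[OF X] by (auto simp: Bseq_def)
  have FH: "F \<in> H2"
  proof (rule H2_I[OF F(1)])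
    fix r :: real assume r: "0 \<le> r" "r < 1"
    show "square_mean F r \<le> B\<^sup>2"
    proof (rule square_mean_limit_le[OF _ F r])
      show "square_mean (fun_of (X n)) r \<le> B\<^sup>2" if "n \<ge> 0" for n
        using square_mean_le_norm[OF r, of "X n"] power_mono[OF B[of n] norm_ge_zero, of 2] by linarith
    qed simp
  qed
  have "X \<longlonglongrightarrow> Hardy F"
  proof (rule LIMSEQ_I)
    fix e :: real assume e: "e > 0"
    then obtain M where M: "\<And>m n. m \<ge> M \<Longrightarrow> n \<ge> M \<Longrightarrow> norm (X m - X n) < e / 2"
      using X unfolding Cauchy_def dist_norm by (meson half_gt_zero)
    have "norm (X n - Hardy F) < e" if n: "n \<ge> M" for n
    proof -
      have "(norm (X n - Hardy F))\<^sup>2 \<le> (e / 2)\<^sup>2"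
      proof (rule norm_power2_le)
        fix r :: real assume r: "0 \<le> r" "r < 1"
        have "square_mean (\<lambda>z. fun_of (X n) z - F z) r \<le> (e / 2)\<^sup>2"
        proof (rule square_mean_limit_le[where f="\<lambda>m. fun_of (X n - X m)"])
          show "square_mean (fun_of (X n - X m)) r \<le> (e / 2)\<^sup>2" if "m \<ge> M" for m
            using square_mean_le_norm[OF r, of "X n - X m"]
              power_mono[OF less_imp_le[OF M[OF n that]] norm_ge_zero, of 2] by linarith
          show "(\<lambda>m. fun_of (X n - X m) z) \<longlonglongrightarrow> fun_of (X n) z - F z" for z
            unfolding fun_of_diff by (intro tendsto_intros F)
        qed (auto intro: analytic_diff F r simp del: fun_of_diff)
        then show "square_mean (fun_of (X n - Hardy F)) r \<le> (e / 2)\<^sup>2" by (simp add: FH)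
      qed
      then have "norm (X n - Hardy F) \<le> e / 2" using e by (simp add: power2_le_iff_abs_le)
      then show ?thesis using e by simp
    qed
    then show "\<exists>N. \<forall>n\<ge>N. norm (X n - Hardy F) < e" by blast
  qed
  then show "convergent X" by (auto simp: convergent_def)
qed

section \<open>Multiplication by bounded functions\<close>

lemma scaleR_in_polydisc:
  fixes z :: "complex ^ 'n::finite"
  assumes "0 \<le> r" "r < 1" "\<And>i. norm (z $ i) \<le> 1"
  shows "r *\<^sub>R z \<in> polydisc"
proof -
  have "norm ((r *\<^sub>R z) $ i) < 1" for i
  proof -
    have "norm ((r *\<^sub>R z) $ i) = r * norm (z $ i)" using assms(1) by simp
    also have "\<dots> \<le> r * 1" by (rule mult_left_mono[OF assms(3,1)])
    finally show ?thesis using assms(2) by simp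
  qed
  then show ?thesis by (simp add: polydisc_def)
qed

definition mult_hardy :: "(complex ^ 'n::finite \<Rightarrow> complex) \<Rightarrow> 'n hardy \<Rightarrow> 'n hardy" where
  "mult_hardy \<phi> x = Hardy (\<lambda>z. \<phi> z * fun_of x z)"

lemma square_mean_mult_le:
  assumes \<phi>: "\<phi> \<in> H_infinity" and B: "\<And>z. z \<in> polydisc \<Longrightarrow> norm (\<phi> z) \<le> B"
    and f: "f \<in> analytic_functions" and r: "0 \<le> r" "r < 1"
  shows "square_mean (\<lambda>z. \<phi> z * f z) r \<le> B\<^sup>2 * square_mean f r"
proof -
  have an: "(\<lambda>z. \<phi> z * f z) \<in> analytic_functions"
    using \<phi> f by (intro analytic_mult) (auto simp: H_infinity_def)
  have "square_mean (\<lambda>z. \<phi> z * f z) r \<le> (\<integral>z. B\<^sup>2 * (norm (f (r *\<^sub>R z)))\<^sup>2 \<partial>torus_measure)"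
    unfolding square_mean_def
  proof (rule integral_mono_AE)
    show "AE z in torus_measure. (norm (\<phi> (r *\<^sub>R z) * f (r *\<^sub>R z)))\<^sup>2 \<le> B\<^sup>2 * (norm (f (r *\<^sub>R z)))\<^sup>2"
      using AE_torus
    proof eventually_elim
      case (elim z)
      then have "r *\<^sub>R z \<in> polydisc" by (intro scaleR_in_polydisc r) simp
      then have "norm (\<phi> (r *\<^sub>R z)) \<le> B" by (rule B)
      then show ?case
        by (simp add: norm_mult power_mult_distrib mult_right_mono power_mono)
    qed
  qed (use integrable_torus_square[OF an r] integrable_torus_square[OF f r] in simp_all)
  then show ?thesis by (simp add: square_mean_def)
qed

lemma H_infinity_bound:
  assumes "\<phi> \<in> H_infinity"
  obtains B where "0 \<le> B" "\<And>z. z \<in> polydisc \<Longrightarrow> norm (\<phi> z) \<le> B"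
proof -
  obtain B where "B > 0" "\<forall>x\<in>\<phi> ` polydisc. norm x \<le> B"
    using assms by (auto simp: H_infinity_def bounded_pos)
  then show ?thesis by (intro that[of B]) auto
qed

lemma H2_mult:
  assumes \<phi>: "\<phi> \<in> H_infinity" and f: "f \<in> H2"
  shows "(\<lambda>z. \<phi> z * f z) \<in> H2"
proof -
  obtain B where B: "0 \<le> B" "\<And>z. z \<in> polydisc \<Longrightarrow> norm (\<phi> z) \<le> B"
    using H_infinity_bound[OF \<phi>] by blast
  show ?thesis
  proof (rule H2_I)
    show "(\<lambda>z. \<phi> z * f z) \<in> analytic_functions"
      using \<phi> H2_analytic[OF f] by (intro analytic_mult) (auto simp: H_infinity_def)
    fix r :: real assume r: "0 \<le> r" "r < 1"
    have "square_mean (\<lambda>z. \<phi> z * f z) r \<le> B\<^sup>2 * square_mean f r"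
      by (rule square_mean_mult_le[OF \<phi> B(2) H2_analytic[OF f] r])
    also have "\<dots> \<le> B\<^sup>2 * (H2_norm f)\<^sup>2"
      by (intro mult_left_mono square_mean_le_H2_norm f r) simp
    finally show "square_mean (\<lambda>z. \<phi> z * f z) r \<le> B\<^sup>2 * (H2_norm f)\<^sup>2" .
  qed
qed

lemma fun_of_mult_hardy [simp]: "\<phi> \<in> H_infinity \<Longrightarrow> fun_of (mult_hardy \<phi> x) = (\<lambda>z. \<phi> z * fun_of x z)"
  by (simp add: mult_hardy_def H2_mult)

lemma bounded_linear_mult_hardy:
  assumes \<phi>: "\<phi> \<in> H_infinity"
  shows "bounded_linear (mult_hardy \<phi>)"
proof -
  obtain B where B: "0 \<le> B" "\<And>z. z \<in> polydisc \<Longrightarrow> norm (\<phi> z) \<le> B"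
    using H_infinity_bound[OF \<phi>] by blast
  show ?thesis
  proof (rule bounded_linear_intro[where K=B])
    show "mult_hardy \<phi> (x + y) = mult_hardy \<phi> x + mult_hardy \<phi> y" for x y
      using \<phi> by (simp add: fun_of_inject[symmetric] distrib_left)
    show "mult_hardy \<phi> (r *\<^sub>R x) = r *\<^sub>R mult_hardy \<phi> x" for r x
      using \<phi> by (simp add: fun_of_inject[symmetric] mult.left_commute)
    show "norm (mult_hardy \<phi> x) \<le> norm x * B" for x
    proof -
      have "(norm (mult_hardy \<phi> x))\<^sup>2 \<le> (norm x * B)\<^sup>2"
      proof (rule norm_power2_le)
        fix r :: real assume r: "0 \<le> r" "r < 1"
        have "square_mean (fun_of (mult_hardy \<phi> x)) r \<le> B\<^sup>2 * square_mean (fun_of x) r"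
          using square_mean_mult_le[OF \<phi> B(2) analytic_fun_of r] \<phi> by simp
        also have "\<dots> \<le> B\<^sup>2 * (norm x)\<^sup>2"
          by (intro mult_left_mono square_mean_le_norm r) simp
        finally show "square_mean (fun_of (mult_hardy \<phi> x)) r \<le> (norm x * B)\<^sup>2"
          by (simp add: power_mult_distrib mult.commute)
      qed
      then show ?thesis using B(1) by (simp add: power2_le_iff_abs_le)
    qed
  qed
qed

section \<open>Dilations and the isometry property\<close>

definition dilate :: "real \<Rightarrow> 'n::finite hardy \<Rightarrow> 'n hardy" where
  "dilate c x = Hardy (\<lambda>z. if z \<in> polydisc then fun_of x (c *\<^sub>R z) else 0)"

lemma scaleR_polydisc: "0 \<le> c \<Longrightarrow> c < 1 \<Longrightarrow> z \<in> polydisc \<Longrightarrow> c *\<^sub>R z \<in> polydisc"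
  by (rule scaleR_in_polydisc) (auto simp: polydisc_def less_imp_le)

lemma analytic_dilate:
  assumes f: "f \<in> analytic_functions" and c: "0 \<le> c" "c < 1"
  shows "(\<lambda>z. if z \<in> polydisc then f (c *\<^sub>R z) else 0) \<in> analytic_functions"
  unfolding analytic_functions_def analytic_several_on_def
proof safe
  fix z :: "complex ^ 'a" assume z: "z \<in> polydisc"
  then obtain D where D: "(f has_derivative D) (at (c *\<^sub>R z))" "\<forall>b v. D (b *s v) = b * D v"
    using f scaleR_polydisc[OF c z] unfolding analytic_functions_def analytic_several_on_def by blast
  have "((\<lambda>z. c *\<^sub>R z) has_derivative (\<lambda>h. c *\<^sub>R h)) (at z)"
    by (intro derivative_eq_intros) simp_all
  from has_derivative_compose[OF this D(1)]
  have "((\<lambda>z. if z \<in> polydisc then f (c *\<^sub>R z) else 0) has_derivative (\<lambda>h. D (c *\<^sub>R h))) (at z)"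
    by (rule has_derivative_transform_within_open[OF _ open_polydisc z]) simp
  moreover have "D (c *\<^sub>R (b *s v)) = b * D (c *\<^sub>R v)" for b v
  proof -
    have "c *\<^sub>R (b *s v) = b *s (c *\<^sub>R v)" by (simp add: vec_eq_iff)
    then show ?thesis using D(2) by simp
  qed
  ultimately show "\<exists>D. ((\<lambda>z. if z \<in> polydisc then f (c *\<^sub>R z) else 0) has_derivative D) (at z)
      \<and> (\<forall>c v. D (c *s v) = c * D v)" by blast
qed simp

lemma square_mean_dilate:
  assumes f: "f \<in> analytic_functions" and c: "0 \<le> c" "c < 1" and r: "0 \<le> r" "r < 1"
  shows "square_mean (\<lambda>z. if z \<in> polydisc then f (c *\<^sub>R z) else 0) r = square_mean f (c * r)"
  unfolding square_mean_def
proof (rule integral_cong_AE)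
  show "AE z in torus_measure. (norm (if r *\<^sub>R z \<in> polydisc then f (c *\<^sub>R r *\<^sub>R z) else 0))\<^sup>2
      = (norm (f ((c * r) *\<^sub>R z)))\<^sup>2"
    using AE_torus by eventually_elim (simp add: scaleR_in_polydisc r)
  have [measurable]: "f \<in> borel_measurable borel"
    "(\<lambda>z. if z \<in> polydisc then f (c *\<^sub>R z) else 0) \<in> borel_measurable borel"
    using f analytic_dilate[OF f c] by (auto intro: analytic_borel_measurable)
  show "(\<lambda>z. (norm (f ((c * r) *\<^sub>R z)))\<^sup>2) \<in> borel_measurable torus_measure"
    by measurable
  have "(\<lambda>z. (norm ((\<lambda>z. if z \<in> polydisc then f (c *\<^sub>R z) else 0) (r *\<^sub>R z)))\<^sup>2) \<in> borel_measurable torus_measure"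
    by measurable
  then show "(\<lambda>z. (norm (if r *\<^sub>R z \<in> polydisc then f (c *\<^sub>R r *\<^sub>R z) else 0))\<^sup>2) \<in> borel_measurable torus_measure"
    by simp
qed

lemma mult_radii:
  fixes c r :: real
  assumes "0 \<le> c" "c < 1" "0 \<le> r" "r < 1"
  shows "0 \<le> c * r" "c * r < 1"
  using assms mult_strict_mono[of c 1 r 1] by auto

lemma fun_of_dilate [simp]:
  assumes c: "0 \<le> c" "c < 1"
  shows "fun_of (dilate c x) = (\<lambda>z. if z \<in> polydisc then fun_of x (c *\<^sub>R z) else 0)"
proof -
  have "(\<lambda>z. if z \<in> polydisc then fun_of x (c *\<^sub>R z) else 0) \<in> H2"
    by (rule H2_I[OF analytic_dilate[OF _ c], where B = "(norm x)\<^sup>2"])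
       (simp_all add: square_mean_dilate c square_mean_le_norm mult_radii)
  then show ?thesis by (simp add: dilate_def)
qed



text \<open>On expanding the square, the mixed term is the mean of \<open>f (r z) * cnj (f (c r z))\<close>, and the radii \<open>r\<close>
  and \<open>c * r\<close> have the geometric mean \<open>sqrt c * r\<close>.\<close>

lemma square_mean_diff_dilate:
  assumes c: "0 \<le> c" "c < 1" and r: "0 \<le> r" "r < 1"
  shows "square_mean (fun_of (x - dilate c x)) r
    = square_mean (fun_of x) r + square_mean (fun_of x) (c * r) - 2 * square_mean (fun_of x) (sqrt c * r)"
proof -
  let ?f = "fun_of x"
  let ?g = "fun_of (dilate c x)"
  have sc: "0 \<le> sqrt c" "sqrt c < 1" using c by (auto simp: real_sqrt_lt_1_iff)
  have swap: "(\<integral>z. ?f (r *\<^sub>R z) * cnj (?g (r *\<^sub>R z)) \<partial>torus_measure) = of_real (square_mean ?f (sqrt c * r))"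
  proof -
    have "(\<integral>z. ?f (r *\<^sub>R z) * cnj (?g (r *\<^sub>R z)) \<partial>torus_measure)
        = (\<integral>z. ?f (r *\<^sub>R z) * cnj (?f ((c * r) *\<^sub>R z)) \<partial>torus_measure)"
    proof (rule integral_cong_AE)
      show "AE z in torus_measure. ?f (r *\<^sub>R z) * cnj (?g (r *\<^sub>R z)) = ?f (r *\<^sub>R z) * cnj (?f ((c * r) *\<^sub>R z))"
        using AE_torus by eventually_elim (simp add: c scaleR_in_polydisc r)
      have [measurable]: "?f \<in> borel_measurable borel" "?g \<in> borel_measurable borel"
        by (rule analytic_borel_measurable, simp del: fun_of_dilate)+
      show "(\<lambda>z. ?f (r *\<^sub>R z) * cnj (?g (r *\<^sub>R z))) \<in> borel_measurable torus_measure"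
        "(\<lambda>z. ?f (r *\<^sub>R z) * cnj (?f ((c * r) *\<^sub>R z))) \<in> borel_measurable torus_measure"
        by measurable
    qed
    also have "\<dots> = of_real (square_mean ?f (sqrt c * r))"
      unfolding square_mean_def
      by (rule torus_mean_swap_radii) (use c r sc mult_radii in auto)
    finally show ?thesis .
  qed
  have int: "integrable torus_measure (\<lambda>z. ?f (r *\<^sub>R z) * cnj (?g (r *\<^sub>R z)))"
    by (intro integrable_torus_product r analytic_fun_of)
  have split: "(\<integral>z. a z + b z - 2 * Re (h z) \<partial>torus_measure)
      = (\<integral>z. a z \<partial>torus_measure) + (\<integral>z. b z \<partial>torus_measure) - 2 * Re (\<integral>z. h z \<partial>torus_measure)"
    if "integrable torus_measure a" "integrable torus_measure b" "integrable torus_measure h"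
    for a b :: "complex ^ 'a \<Rightarrow> real" and h
    using that by simp
  have "square_mean (fun_of (x - dilate c x)) r
     = (\<integral>z. (norm (?f (r *\<^sub>R z)))\<^sup>2 + (norm (?g (r *\<^sub>R z)))\<^sup>2 - 2 * Re (?f (r *\<^sub>R z) * cnj (?g (r *\<^sub>R z))) \<partial>torus_measure)"
    unfolding square_mean_def fun_of_diff
  proof (rule Bochner_Integration.integral_cong[OF refl])
    show "(norm (a - b))\<^sup>2 = (norm a)\<^sup>2 + (norm b)\<^sup>2 - 2 * Re (a * cnj b)" for a b :: complex
      unfolding cmod_power2 by (simp add: power2_eq_square algebra_simps)
  qed
  also have "\<dots> = square_mean ?f r + square_mean ?g r - 2 * Re (\<integral>z. ?f (r *\<^sub>R z) * cnj (?g (r *\<^sub>R z)) \<partial>torus_measure)"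
    unfolding square_mean_def
    by (rule split[OF integrable_torus_square[OF analytic_fun_of r] integrable_torus_square[OF analytic_fun_of r] int])
  also have "square_mean ?g r = square_mean ?f (c * r)"
    using c r by (simp add: square_mean_dilate)
  finally show ?thesis unfolding swap by simp
qed

text \<open>By monotonicity, the square mean of the difference is at most \<open>(norm x)\<^sup>2\<close> minus that of \<open>x\<close> at the radius
  \<open>sqrt c * r\<close>, and the latter is close to \<open>(norm x)\<^sup>2\<close> once this radius exceeds a suitable \<open>s < 1\<close>.\<close>

lemma dilate_approximates:
  assumes e: "0 < e"
  obtains c where "0 \<le> c" "c < 1" "(norm (x - dilate c x))\<^sup>2 < e"
proof -
  obtain s where s: "0 \<le> s" "s < 1" "(norm x)\<^sup>2 - e / 2 < square_mean (fun_of x) s"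
  proof -
    have "(norm x)\<^sup>2 - e / 2 < (norm x)\<^sup>2" using e by simp
    then have "eventually (\<lambda>s. (norm x)\<^sup>2 - e / 2 < square_mean (fun_of x) s) (at_left 1)"
      unfolding norm_hardy_def by (rule order_tendstoD(1)[OF square_mean_tendsto[OF fun_of_H2]])
    then have "eventually (\<lambda>s. (0 \<le> s \<and> s < 1) \<and> (norm x)\<^sup>2 - e / 2 < square_mean (fun_of x) s) (at_left 1)"
      by (intro eventually_conj eventually_at_left_1)
    then show ?thesis using that eventually_happens'[OF trivial_limit_at_left_real] by blast
  qed
  define t where "t = (1 + s) / 2"
  define c where "c = t\<^sup>2"
  have t: "0 < t" "t < 1" "s < t" using s by (auto simp: t_def)
  have c: "0 \<le> c" "c < 1" using t by (auto simp: c_def power2_eq_square mult_radii)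
  have sqc: "sqrt c = t" using t by (simp add: c_def)
  have "((\<lambda>r. square_mean (fun_of (x - dilate c x)) r) \<longlongrightarrow> (norm (x - dilate c x))\<^sup>2) (at_left 1)"
    unfolding norm_hardy_def by (rule square_mean_tendsto) (rule fun_of_H2)
  moreover have "eventually (\<lambda>r. square_mean (fun_of (x - dilate c x)) r \<le> e / 2) (at_left 1)"
  proof -
    have "s / t < 1" using t by simp
    then have "eventually (\<lambda>r. r \<in> {s / t<..<1}) (at_left (1::real))"
      by (rule eventually_at_left_real)
    then show ?thesis
    proof eventually_elim
      case (elim r)
      have "0 \<le> s / t" using s t by simp
      then have r: "0 \<le> r" "r < 1" using elim by auto
      have "c * r \<le> sqrt c * r"
        using t r by (intro mult_right_mono) (auto simp: sqc c_def power2_eq_square mult_le_one)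
      then have "square_mean (fun_of x) (c * r) \<le> square_mean (fun_of x) (sqrt c * r)"
        unfolding square_mean_def using c r t
        by (intro torus_mean_mono mult_radii) (auto simp: sqc mult_radii)
      moreover have "square_mean (fun_of x) s \<le> square_mean (fun_of x) (sqrt c * r)"
        unfolding square_mean_def using s r t elim
        by (intro torus_mean_mono) (auto simp: sqc mult_radii field_simps)
      ultimately show ?case
        using square_mean_diff_dilate[OF c r, of x] square_mean_le_norm[OF r, of x] s(3) by linarith
    qed
  qed
  ultimately have "(norm (x - dilate c x))\<^sup>2 \<le> e / 2"
    by (rule tendsto_upperbound) simp
  then show ?thesis using e by (intro that[OF c]) simp
qed

text \<open>The dilate extends continuously to the closed polydisc, so that only the boundary values of
  the inner factor matter; they are unimodular.\<close>

lemma norm_mult_inner_dilate: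
  fixes x :: "'n::finite hardy"
  assumes \<phi>: "inner_function \<phi>" and c: "0 \<le> c" "c < 1"
  shows "(norm (mult_hardy \<phi> (dilate c x)))\<^sup>2 = square_mean (fun_of x) c"
proof -
  have \<phi>H: "\<phi> \<in> H_infinity" using \<phi> by (simp add: inner_function_def)
  let ?h = "fun_of (mult_hardy \<phi> (dilate c x))"
  define \<rho> where "\<rho> k = 1 - inverse (real (Suc k))" for k
  have \<rho>: "0 \<le> \<rho> k" "\<rho> k < 1" for k
    by (auto simp: \<rho>_def field_simps)
  have "\<rho> = (\<lambda>k. 1 + - inverse (real (Suc k)))" by (simp add: \<rho>_def fun_eq_iff)
  then have \<rho>1: "\<rho> \<longlonglongrightarrow> 1"
    using LIMSEQ_inverse_real_of_nat_add_minus[of 1] by (simp only:)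
  then have \<rho>lim: "filterlim \<rho> (at_left 1) sequentially"
    using \<rho> by (auto simp: filterlim_at less_imp_neq)
  have lim1: "(\<lambda>k. square_mean ?h (\<rho> k)) \<longlonglongrightarrow> (norm (mult_hardy \<phi> (dilate c x)))\<^sup>2"
    unfolding norm_hardy_def
    by (rule filterlim_compose[OF square_mean_tendsto[OF fun_of_H2] \<rho>lim])
  obtain B where B: "0 \<le> B" "\<And>z. z \<in> polydisc \<Longrightarrow> norm (\<phi> z) \<le> B"
    using H_infinity_bound[OF \<phi>H] by blast
  obtain C where C: "0 \<le> C" "\<And>z. (\<And>i. norm (z $ i) \<le> c) \<Longrightarrow> norm (fun_of x z) \<le> C"
    using analytic_bounded_on_subdisc[OF analytic_fun_of c(2)] by blast
  have [measurable]: "fun_of y \<in> borel_measurable borel" for y :: "'n hardy"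
    by (rule analytic_borel_measurable) simp
  have lim2: "(\<lambda>k. square_mean ?h (\<rho> k)) \<longlonglongrightarrow> square_mean (fun_of x) c"
    unfolding square_mean_def
  proof (rule integral_dominated_convergence)
    have AE\<phi>: "AE z in torus_measure. \<exists>l. ((\<lambda>r::real. \<phi> (r *\<^sub>R z)) \<longlongrightarrow> l) (at_left 1) \<and> norm l = 1"
      using \<phi> by (simp add: inner_function_def)
    show "AE z in torus_measure. (\<lambda>k. (norm (?h (\<rho> k *\<^sub>R z)))\<^sup>2) \<longlonglongrightarrow> (norm (fun_of x (c *\<^sub>R z)))\<^sup>2"
      using AE_torus AE\<phi>
    proof eventually_elim
      case (elim z)
      then obtain l where l: "((\<lambda>r::real. \<phi> (r *\<^sub>R z)) \<longlongrightarrow> l) (at_left 1)" "norm l = 1" by blast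
      have in1: "\<rho> k *\<^sub>R z \<in> polydisc" for k
        using elim by (intro scaleR_in_polydisc \<rho>) simp
      have h: "?h (\<rho> k *\<^sub>R z) = \<phi> (\<rho> k *\<^sub>R z) * fun_of x (c *\<^sub>R \<rho> k *\<^sub>R z)" for k
        using in1[of k] by (simp add: \<phi>H c del: scaleR_scaleR)
      have "c *\<^sub>R z \<in> polydisc" using elim by (intro scaleR_in_polydisc c) simp
      then have cont: "isCont (fun_of x) (c *\<^sub>R z)"
        using analytic_continuous_on[OF analytic_fun_of] open_polydisc continuous_on_eq_continuous_at by blast
      have "(\<lambda>k. c *\<^sub>R \<rho> k *\<^sub>R z) \<longlonglongrightarrow> c *\<^sub>R 1 *\<^sub>R z"
        by (intro tendsto_intros \<rho>1)
      then have "(\<lambda>k. c *\<^sub>R \<rho> k *\<^sub>R z) \<longlonglongrightarrow> c *\<^sub>R z" by simp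
      from isCont_tendsto_compose[OF cont this]
      have "(\<lambda>k. (norm (\<phi> (\<rho> k *\<^sub>R z) * fun_of x (c *\<^sub>R \<rho> k *\<^sub>R z)))\<^sup>2) \<longlonglongrightarrow> (norm (l * fun_of x (c *\<^sub>R z)))\<^sup>2"
        by (intro tendsto_intros filterlim_compose[OF l(1) \<rho>lim])
      then show ?case unfolding h by (simp only: norm_mult l(2) mult_1)
    qed
    show "AE z in torus_measure. norm ((norm (?h (\<rho> k *\<^sub>R z)))\<^sup>2) \<le> (B * C)\<^sup>2" for k
      using AE_torus
    proof eventually_elim
      case (elim z)
      have in1: "\<rho> k *\<^sub>R z \<in> polydisc"
        using elim by (intro scaleR_in_polydisc \<rho>) simp
      have h: "?h (\<rho> k *\<^sub>R z) = \<phi> (\<rho> k *\<^sub>R z) * fun_of x (c *\<^sub>R \<rho> k *\<^sub>R z)"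
        using in1 by (simp add: \<phi>H c del: scaleR_scaleR)
      have "norm ((c *\<^sub>R \<rho> k *\<^sub>R z) $ i) \<le> c" for i
        using elim c \<rho>[of k] by (simp add: mult_left_le less_imp_le)
      then have "norm (?h (\<rho> k *\<^sub>R z)) \<le> B * C"
        unfolding h norm_mult by (intro mult_mono B in1 C) auto
      then show ?case by (simp add: power_mono del: fun_of_mult_hardy)
    qed
  qed (simp_all del: fun_of_mult_hardy)
  show ?thesis by (rule LIMSEQ_unique[OF lim1 lim2])
qed

lemma inner_function_one: "inner_function (\<lambda>_. 1)"
  by (auto simp: inner_function_def H_infinity_def analytic_several_const bounded_iff intro!: exI[of _ 1])

text \<open>Both sides are continuous in \<open>x\<close> and agree on dilates; the norm of a dilate is obtained from
  \<open>norm_mult_inner_dilate\<close> with the constant inner function 1.\<close>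

lemma norm_mult_inner [simp]:
  assumes \<phi>: "inner_function \<phi>"
  shows "norm (mult_hardy \<phi> x) = norm x"
proof -
  have \<phi>H: "\<phi> \<in> H_infinity" using \<phi> by (simp add: inner_function_def)
  interpret M: bounded_linear "mult_hardy \<phi>" by (rule bounded_linear_mult_hardy[OF \<phi>H])
  have d: "norm (mult_hardy \<phi> (dilate c x)) = norm (dilate c x)" if "0 \<le> c" "c < 1" for c
  proof -
    have "mult_hardy (\<lambda>_. 1) y = y" for y :: "'a hardy"
      by (simp add: mult_hardy_def fun_of_inverse)
    then have "(norm (mult_hardy \<phi> (dilate c x)))\<^sup>2 = (norm (dilate c x))\<^sup>2"
      using norm_mult_inner_dilate[OF \<phi> that, of x] norm_mult_inner_dilate[OF inner_function_one that, of x] by simp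
    then show ?thesis by simp
  qed
  obtain K where K: "K > 0" "\<And>y. norm (mult_hardy \<phi> y) \<le> norm y * K"
    using M.pos_bounded by blast
  have "\<bar>norm (mult_hardy \<phi> x) - norm x\<bar> \<le> e" if e: "e > 0" for e
  proof -
    have "0 < (e / (K + 1))\<^sup>2" using e K by simp
    then obtain c where c: "0 \<le> c" "c < 1" "(norm (x - dilate c x))\<^sup>2 < (e / (K + 1))\<^sup>2"
      by (rule dilate_approximates)
    have n: "norm (x - dilate c x) < e / (K + 1)"
      using c(3) by (rule power2_less_imp_less) (use e K in simp)
    have "\<bar>norm (mult_hardy \<phi> x) - norm (mult_hardy \<phi> (dilate c x))\<bar> \<le> norm (x - dilate c x) * K"
      using norm_triangle_ineq3[of "mult_hardy \<phi> x" "mult_hardy \<phi> (dilate c x)"] K(2)[of "x - dilate c x"]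
      by (simp add: M.diff)
    moreover have "\<bar>norm x - norm (dilate c x)\<bar> \<le> norm (x - dilate c x)"
      by (rule norm_triangle_ineq3)
    moreover have "norm (x - dilate c x) * K + norm (x - dilate c x) \<le> e"
      using n K by (simp add: field_simps)
    ultimately show ?thesis using d[OF c(1,2)] by linarith
  qed
  then have "\<bar>norm (mult_hardy \<phi> x) - norm x\<bar> \<le> 0"
    by (rule field_le_epsilon) simp
  then show ?thesis by simp
qed

section \<open>Closest points in complete subspaces\<close>

text \<open>If \<open>y\<close> had a nonzero component along \<open>x - p\<close>, moving \<open>p\<close> by the projection of \<open>x - p\<close> onto \<open>y\<close> would bring it
  closer to \<open>x\<close>.\<close>

lemma closest_point_orthogonal:
  fixes x :: "'a::real_inner"
  assumes S: "subspace S" and p: "p \<in> S" and min: "\<And>y. y \<in> S \<Longrightarrow> norm (x - p) \<le> norm (x - y)" and y: "y \<in> S"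
  shows "(x - p) \<bullet> y = 0"
proof (rule ccontr)
  assume ne: "(x - p) \<bullet> y \<noteq> 0"
  then have y0: "y \<bullet> y > 0" by auto
  define t where "t = (x - p) \<bullet> y / (y \<bullet> y)"
  have "p + t *\<^sub>R y \<in> S" using S p y by (intro subspace_add subspace_scale)
  from min[OF this] have "(x - p) \<bullet> (x - p) \<le> (x - p - t *\<^sub>R y) \<bullet> (x - p - t *\<^sub>R y)"
    by (simp add: norm_le diff_diff_eq)
  also have "\<dots> = (x - p) \<bullet> (x - p) - 2 * t * ((x - p) \<bullet> y) + t * t * (y \<bullet> y)"
    by (simp add: inner_diff_left inner_diff_right inner_commute algebra_simps)
  also have "t * t * (y \<bullet> y) = t * ((x - p) \<bullet> y)"
    using y0 by (simp add: t_def)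
  finally have "t * ((x - p) \<bullet> y) \<le> 0" by simp
  moreover have "t * ((x - p) \<bullet> y) = ((x - p) \<bullet> y)\<^sup>2 / (y \<bullet> y)"
    by (simp add: t_def power2_eq_square)
  moreover have "((x - p) \<bullet> y)\<^sup>2 / (y \<bullet> y) > 0"
    using ne y0 by simp
  ultimately show False by simp
qed

text \<open>A minimizing sequence is Cauchy by the parallelogram law.\<close>

lemma complete_subspace_closest_point:
  fixes x :: "'a::real_inner"
  assumes S: "subspace S" and complete: "uniform_space_class.complete S"
  obtains p where "p \<in> S" "\<And>y. y \<in> S \<Longrightarrow> norm (x - p) \<le> norm (x - y)"
proof -
  have S0: "S \<noteq> {}" using subspace_0[OF S] by auto
  define d where "d = (INF y\<in>S. (norm (x - y))\<^sup>2)"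
  have bdd: "bdd_below ((\<lambda>y. (norm (x - y))\<^sup>2) ` S)" by (rule bdd_belowI2[where m=0]) simp
  have d: "d \<le> (norm (x - y))\<^sup>2" if "y \<in> S" for y
    unfolding d_def by (rule cINF_lower[OF bdd that])
  have "\<exists>y\<in>S. (norm (x - y))\<^sup>2 < d + inverse (real (Suc n))" for n
  proof -
    have "d < d + inverse (real (Suc n))" by simp
    then show ?thesis unfolding d_def cINF_less_iff[OF S0 bdd] by blast
  qed
  then obtain s where s: "\<And>n. s n \<in> S" "\<And>n. (norm (x - s n))\<^sup>2 < d + inverse (real (Suc n))"
    by metis
  have dist: "(norm (s m - s n))\<^sup>2 \<le> 2 * inverse (real (Suc m)) + 2 * inverse (real (Suc n))" for m n
  proof -
    have "(1 / 2) *\<^sub>R (s m + s n) \<in> S" using S s by (intro subspace_add subspace_scale)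
    from d[OF this] have "4 * d \<le> 4 * (norm (x - (1 / 2) *\<^sub>R (s m + s n)))\<^sup>2" by simp
    also have "\<dots> = (norm (2 *\<^sub>R (x - (1 / 2) *\<^sub>R (s m + s n))))\<^sup>2"
      by (simp add: power_mult_distrib)
    also have "2 *\<^sub>R (x - (1 / 2) *\<^sub>R (s m + s n)) = (x - s m) + (x - s n)"
      by (simp add: algebra_simps scaleR_2)
    also have "(norm ((x - s m) + (x - s n)))\<^sup>2 + (norm (s m - s n))\<^sup>2
        = 2 * (norm (x - s m))\<^sup>2 + 2 * (norm (x - s n))\<^sup>2"
      by (simp add: power2_norm_eq_inner inner_diff_left inner_diff_right inner_add_left inner_add_right inner_commute algebra_simps)
    finally show ?thesis using s(2)[of m] s(2)[of n] by linarith
  qed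
  have "Cauchy s"
    unfolding Cauchy_def
  proof (intro allI impI)
    fix e :: real assume e: "e > 0"
    then obtain N where N: "inverse (real (Suc N)) < e\<^sup>2 / 4"
      using reals_Archimedean[of "e\<^sup>2 / 4"] by auto
    have "dist (s m) (s n) < e" if "m \<ge> N" "n \<ge> N" for m n
    proof -
      have "inverse (real (Suc m)) \<le> inverse (real (Suc N))" "inverse (real (Suc n)) \<le> inverse (real (Suc N))"
        using that by (simp_all add: le_imp_inverse_le)
      then have "(norm (s m - s n))\<^sup>2 < e\<^sup>2" using dist[of m n] N by linarith
      then show ?thesis unfolding dist_norm by (rule power2_less_imp_less) (use e in simp)
    qed
    then show "\<exists>M. \<forall>m\<ge>M. \<forall>n\<ge>M. dist (s m) (s n) < e" by blast
  qed
  then obtain p where p: "p \<in> S" "s \<longlonglongrightarrow> p"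
    using complete s(1) unfolding metric_space_class.complete_def by blast
  have "(norm (x - p))\<^sup>2 \<le> d"
  proof (rule LIMSEQ_le)
    show "(\<lambda>n. (norm (x - s n))\<^sup>2) \<longlonglongrightarrow> (norm (x - p))\<^sup>2" by (intro tendsto_intros p)
    show "(\<lambda>n. d + inverse (real (Suc n))) \<longlonglongrightarrow> d"
      using LIMSEQ_inverse_real_of_nat_add[of d] .
    show "\<exists>N. \<forall>n\<ge>N. (norm (x - s n))\<^sup>2 \<le> d + inverse (real (Suc n))"
      using s(2) less_imp_le by blast
  qed
  then have "norm (x - p) \<le> norm (x - y)" if "y \<in> S" for y
    using d[OF that] by (meson norm_ge_zero order_trans power2_le_imp_le)
  with p show ?thesis by (intro that)
qed

section \<open>Model spaces and truncated Toeplitz operators\<close>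

text \<open>The complex structure, which the class \<open>real_inner\<close> does not see.\<close>

definition hinner :: "'n::finite hardy \<Rightarrow> 'n hardy \<Rightarrow> complex" where
  "hinner x y = H2_inner (fun_of x) (fun_of y)"

definition hscale :: "complex \<Rightarrow> 'n::finite hardy \<Rightarrow> 'n hardy" where
  "hscale c x = Hardy (\<lambda>z. c * fun_of x z)"

lemma fun_of_hscale [simp]: "fun_of (hscale c x) = (\<lambda>z. c * fun_of x z)"
  by (simp add: hscale_def H2_cmult)

lemma hinner_commute: "hinner x y = cnj (hinner y x)"
  unfolding hinner_def by (rule H2_inner_commute) simp_all

lemma hinner_add_left: "hinner (x + y) z = hinner x z + hinner y z"
  by (simp add: hinner_def H2_inner_add_left)

lemma hinner_hscale_left: "hinner (hscale c x) y = c * hinner x y"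
  by (simp add: hinner_def H2_inner_cmult_left)

lemma hscale_minus_1: "hscale (- 1) x = - x"
  by (simp add: fun_of_inject[symmetric])

lemma hinner_diff_left: "hinner (x - y) z = hinner x z - hinner y z"
  using hinner_add_left[of x "- y" z] hinner_hscale_left[of "- 1" y z] by (simp add: hscale_minus_1)

lemma hinner_add_right: "hinner x (y + z) = hinner x y + hinner x z"
  by (subst (1 2 3) hinner_commute) (simp add: hinner_add_left)

lemma hinner_hscale_right: "hinner x (hscale c y) = cnj c * hinner x y"
  by (subst (1 2) hinner_commute) (simp add: hinner_hscale_left)

lemma Re_hinner: "Re (hinner x y) = x \<bullet> y"
  by (simp add: hinner_def inner_hardy_def)

lemma Im_hinner: "Im (hinner x y) = x \<bullet> hscale \<i> y"
  by (simp add: Re_hinner[symmetric] hinner_hscale_right)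

lemma hinner_self_eq_0: "hinner x x = 0 \<Longrightarrow> x = 0"
  using Re_hinner[of x x] by simp

locale inner_multiplier =
  fixes \<phi> :: "complex ^ 'n::finite \<Rightarrow> complex"
  assumes inner: "inner_function \<phi>"
begin

lemma in_H_infinity: "\<phi> \<in> H_infinity"
  using inner by (simp add: inner_function_def)

sublocale bounded_linear "mult_hardy \<phi>"
  by (rule bounded_linear_mult_hardy[OF in_H_infinity])

lemma mult_hscale: "mult_hardy \<phi> (hscale c x) = hscale c (mult_hardy \<phi> x)"
  by (simp add: fun_of_inject[symmetric] in_H_infinity mult.left_commute)

text \<open>Polarization: isometric linear maps preserve the real inner product, hence the complex one.\<close>

lemma hinner_mult: "hinner (mult_hardy \<phi> x) (mult_hardy \<phi> y) = hinner x y"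
proof -
  have real: "mult_hardy \<phi> x \<bullet> mult_hardy \<phi> y = x \<bullet> y" for x y
    unfolding dot_norm by (simp add: norm_mult_inner[OF inner] flip: add)
  show ?thesis
    by (rule complex_eqI) (simp_all only: Re_hinner Im_hinner real flip: mult_hscale)
qed

definition model :: "'n hardy set" where
  "model = {x. \<forall>y. hinner x (mult_hardy \<phi> y) = 0}"

lemma model_space_eq: "model_space \<phi> = fun_of ` model"
proof
  show "fun_of ` model \<subseteq> model_space \<phi>"
  proof clarsimp
    fix x assume x: "x \<in> model"
    have "H2_inner (fun_of x) (\<lambda>z. \<phi> z * g z) = 0" if "g \<in> H2" for g
      using x that by (auto simp: model_def hinner_def in_H_infinity dest: spec[of _ "Hardy g"])
    then show "fun_of x \<in> model_space \<phi>" by (simp add: model_space_def)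
  qed
  show "model_space \<phi> \<subseteq> fun_of ` model"
  proof
    fix f assume f: "f \<in> model_space \<phi>"
    then have "Hardy f \<in> model" "f = fun_of (Hardy f)"
      by (auto simp: model_space_def model_def hinner_def in_H_infinity)
    then show "f \<in> fun_of ` model" by blast
  qed
qed

text \<open>The range of multiplication is invariant under \<open>hscale \<i>\<close>, so real orthogonality to it gives
  complex orthogonality.\<close>

lemma real_orthogonal_imp_in_model:
  assumes "\<And>y. x \<bullet> mult_hardy \<phi> y = 0"
  shows "x \<in> model"
  unfolding model_def
proof clarify
  fix y
  show "hinner x (mult_hardy \<phi> y) = 0"
    by (rule complex_eqI) (simp_all only: Re_hinner Im_hinner assms zero_complex.sel flip: mult_hscale)
qed

text \<open>The range of an isometry of a complete space is complete, so it contains a point closest to \<open>x\<close>.\<close>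

lemma decomposition: obtains p k where "x = p + mult_hardy \<phi> k" "p \<in> model"
proof -
  have sub: "subspace (range (mult_hardy \<phi>))"
    by (intro linear_subspace_image linear_axioms subspace_UNIV)
  have "uniform_space_class.complete (range (mult_hardy \<phi>))"
    by (rule complete_isometric_image[of 1])
       (auto simp: norm_mult_inner[OF inner] bounded_linear_axioms complete_UNIV subspace_UNIV)
  then obtain q where q: "q \<in> range (mult_hardy \<phi>)"
    "\<And>y. y \<in> range (mult_hardy \<phi>) \<Longrightarrow> norm (x - q) \<le> norm (x - y)"
    using complete_subspace_closest_point[OF sub, of x] by blast
  then obtain k where k: "q = mult_hardy \<phi> k" by blast
  have "x - q \<in> model"
    by (rule real_orthogonal_imp_in_model) (rule closest_point_orthogonal[OF sub q], auto)
  then show ?thesis using k by (intro that[of "x - q" k]) auto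
qed

lemma model_diff: "x \<in> model \<Longrightarrow> y \<in> model \<Longrightarrow> x - y \<in> model"
  by (simp add: model_def hinner_diff_left)

text \<open>Two vectors that fit the definite description in \<open>H2_proj\<close> differ by an element of \<open>model\<close> that is
  orthogonal to \<open>model\<close>, hence to itself.\<close>

lemma H2_proj_eq:
  assumes p: "p \<in> model"
  shows "H2_proj (model_space \<phi>) (fun_of (p + mult_hardy \<phi> k)) = fun_of p"
proof -
  let ?x = "p + mult_hardy \<phi> k"
  have conv: "H2_inner (\<lambda>z. fun_of ?x z - fun_of g z) (fun_of h) = hinner (?x - g) h" for g h
    by (simp add: hinner_def del: fun_of_add)
  have uniq: "g = p" if g: "g \<in> model" "\<And>h. h \<in> model \<Longrightarrow> hinner (?x - g) h = 0" for g
  proof -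
    have d: "p - g \<in> model" by (intro model_diff p g)
    have "hinner (mult_hardy \<phi> k) (p - g) = 0"
      using d by (subst hinner_commute) (simp add: model_def)
    then have "hinner (p - g) (p - g) = 0"
      using g(2)[OF d] by (simp add: hinner_add_left hinner_diff_left)
    then show ?thesis using hinner_self_eq_0 by force
  qed
  show ?thesis
    unfolding H2_proj_def
  proof (rule the_equality)
    have "hinner (?x - p) h = 0" if "h \<in> model" for h
      using that by (subst hinner_commute) (simp add: model_def)
    then show "fun_of p \<in> model_space \<phi> \<and> (\<forall>h\<in>model_space \<phi>. H2_inner (\<lambda>z. fun_of ?x z - fun_of p z) h = 0)"
      unfolding model_space_eq using p by (auto simp: conv simp del: fun_of_add)
  next
    fix g assume "g \<in> model_space \<phi> \<and> (\<forall>h\<in>model_space \<phi>. H2_inner (\<lambda>z. fun_of ?x z - g z) h = 0)"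
    then obtain g' where g': "g = fun_of g'" "g' \<in> model" "\<And>h. h \<in> model \<Longrightarrow> hinner (?x - g') h = 0"
      unfolding model_space_eq by (auto simp: conv simp del: fun_of_add)
    then show "g = fun_of p" using uniq by blast
  qed
qed

text \<open>With \<open>mult_hardy \<theta> x = p + mult_hardy \<phi> k\<close> as in \<open>decomposition\<close>, the left side has the
  norm of \<open>x\<close>. By Pythagoras' theorem the projection \<open>p\<close> has this norm if and only if \<open>mult_hardy \<phi> k = 0\<close>.\<close>

lemma isometry_iff_invariant:
  assumes \<theta>: "inner_function \<theta>"
  shows "H2_isometry_on (model_space \<phi>) (truncated_toeplitz \<phi> \<theta>) \<longleftrightarrow> (\<forall>x\<in>model. mult_hardy \<theta> x \<in> model)"
proof -
  have \<theta>H: "\<theta> \<in> H_infinity" using \<theta> by (simp add: inner_function_def)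
  have key: "H2_norm (truncated_toeplitz \<phi> \<theta> (fun_of x)) = H2_norm (fun_of x) \<longleftrightarrow> mult_hardy \<theta> x \<in> model" for x
  proof -
    obtain p k where pk: "mult_hardy \<theta> x = p + mult_hardy \<phi> k" "p \<in> model"
      by (rule decomposition)
    have "truncated_toeplitz \<phi> \<theta> (fun_of x) = H2_proj (model_space \<phi>) (fun_of (mult_hardy \<theta> x))"
      by (simp add: truncated_toeplitz_def \<theta>H)
    then have T: "truncated_toeplitz \<phi> \<theta> (fun_of x) = fun_of p"
      unfolding pk(1) H2_proj_eq[OF pk(2)] .
    have orth: "p \<bullet> mult_hardy \<phi> k = 0" using pk(2) by (simp add: model_def Re_hinner[symmetric])
    have pyth: "(norm x)\<^sup>2 = (norm p)\<^sup>2 + (norm (mult_hardy \<phi> k))\<^sup>2"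
    proof -
      have "(norm x)\<^sup>2 = (norm (p + mult_hardy \<phi> k))\<^sup>2"
        using norm_mult_inner[OF \<theta>, of x] pk(1) by simp
      also have "\<dots> = (norm p)\<^sup>2 + (norm (mult_hardy \<phi> k))\<^sup>2"
        by (simp add: power2_norm_eq_inner inner_add_left inner_add_right inner_commute orth)
      finally show ?thesis .
    qed
    have "norm p = norm x \<longleftrightarrow> mult_hardy \<theta> x \<in> model"
    proof
      assume "norm p = norm x"
      then have "mult_hardy \<phi> k = 0" using pyth by simp
      then show "mult_hardy \<theta> x \<in> model" using pk by simp
    next
      assume "mult_hardy \<theta> x \<in> model"
      then have "mult_hardy \<phi> k \<in> model" using model_diff[OF _ pk(2)] pk(1) by force
      then have "hinner (mult_hardy \<phi> k) (mult_hardy \<phi> k) = 0" by (simp add: model_def)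
      then have "mult_hardy \<phi> k = 0" by (rule hinner_self_eq_0)
      then show "norm p = norm x" using pyth by simp
    qed
    then show ?thesis by (simp add: T norm_hardy_def)
  qed
  show ?thesis
    unfolding H2_isometry_on_def model_space_eq by (simp add: key)
qed

end

text \<open>An arbitrary \<open>h\<close> is decomposed along \<open>\<phi>\<close>: one part is handled by the invariance, the other by
  commuting the two multiplications.\<close>

lemma model_space_invariant_swap:
  assumes \<phi>: "inner_function \<phi>" and \<theta>: "inner_function \<theta>"
    and inv: "\<And>x. x \<in> inner_multiplier.model \<phi> \<Longrightarrow> mult_hardy \<theta> x \<in> inner_multiplier.model \<phi>"
    and g: "g \<in> inner_multiplier.model \<theta>"
  shows "mult_hardy \<phi> g \<in> inner_multiplier.model \<theta>"
proof -
  interpret \<phi>: inner_multiplier \<phi> by unfold_locales (rule \<phi>)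
  interpret \<theta>: inner_multiplier \<theta> by unfold_locales (rule \<theta>)
  have comm: "mult_hardy \<theta> (mult_hardy \<phi> k) = mult_hardy \<phi> (mult_hardy \<theta> k)" for k
    by (simp add: fun_of_inject[symmetric] \<phi>.in_H_infinity \<theta>.in_H_infinity mult.left_commute)
  have "hinner (mult_hardy \<phi> g) (mult_hardy \<theta> h) = 0" for h
  proof -
    obtain f k where h: "h = f + mult_hardy \<phi> k" and f: "f \<in> \<phi>.model"
      by (rule \<phi>.decomposition)
    have "hinner (mult_hardy \<theta> f) (mult_hardy \<phi> g) = 0"
      using inv[OF f] by (simp add: \<phi>.model_def)
    then have "hinner (mult_hardy \<phi> g) (mult_hardy \<theta> f) = 0"
      by (subst hinner_commute) simp
    moreover have "hinner (mult_hardy \<phi> g) (mult_hardy \<theta> (mult_hardy \<phi> k)) = 0"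
      using g by (simp add: comm \<phi>.hinner_mult \<theta>.model_def)
    ultimately show ?thesis by (simp add: h \<theta>.add hinner_add_right)
  qed
  then show ?thesis by (simp add: \<theta>.model_def)
qed

theorem corollary4p7:
  fixes \<phi>1 \<phi>2 :: "complex ^ 'n::finite \<Rightarrow> complex"
  assumes "CARD('n) > 1"
    and "inner_function \<phi>1" and "\<not> \<phi>1 constant_on polydisc"
    and "inner_function \<phi>2" and "\<not> \<phi>2 constant_on polydisc"
  shows "H2_isometry_on (model_space \<phi>1) (truncated_toeplitz \<phi>1 \<phi>2) \<longleftrightarrow>
         H2_isometry_on (model_space \<phi>2) (truncated_toeplitz \<phi>2 \<phi>1)"
proof -
  interpret \<phi>1: inner_multiplier \<phi>1 by unfold_locales fact
  interpret \<phi>2: inner_multiplier \<phi>2 by unfold_locales fact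
  show ?thesis
    unfolding \<phi>1.isometry_iff_invariant[OF assms(4)] \<phi>2.isometry_iff_invariant[OF assms(2)]
    using model_space_invariant_swap[OF assms(2,4)] model_space_invariant_swap[OF assms(4,2)] by blast
qed

end
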